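(* For $n\geq 3$ and $\mathbf{d}=(d_0,\ldots,d_{n-1})$ and $\mathbf{d}'=(d_0',\ldots,d_{n-1}')$ in $\mathcal{C}_n\cup\mathcal{BC}_n$, if after a permutation $d_i\leq d_i'$ for all $i$, and $d_i<d_i'$ for some $i$, then $D_0(\mathbf{d})<D_0(\mathbf{d}')$.
   Context: For $d>0$ and $J\geq d/2$ let $\theta(d,J)=2\sin^{-1}(\sinh(d/2)/\sinh J)\in[0,\pi]$. Define $$\mathcal{C}_n=\Big\{(d_0,\ldots,d_{n-1})\in(0,\infty)^n : \sum_{i=0}^{n-1}\theta(d_i,D/2)>2\pi,\ D=\max_i d_i\Big\},$$ $$\mathcal{BC}_n=\Big\{(d_0,\ldots,d_{n-1})\in(0,\infty)^n : \sum_{i=0}^{n-1}\theta(d_i,D/2)=2\pi,\ D=\max_i d_i\Big\}.$$ Both are subsets of $\mathcal{AC}_n=\{(d_0,\ldots,d_{n-1})\in(0,\infty)^n : \sinh(d_i/2)<\sum_{j\neq i}\sinh(d_j/2)\text{ for each } i\}$. A cyclic $n$-gon in the hyperbolic plane $\mathbb{H}^2$ with side length collection $(d_0,\ldots,d_{n-1})$ is a set $\{x_0,\ldots,x_{n-1}\}$ of points on a hyperbolic metric circle, cyclically ordered counterclockwise (for each $i$ with $1\le i\le n-1$, the counterclockwise half-open arc $(x_{i-1},x_i]$ contains no $x_j$ with $j\neq i$), such that $\mathrm{dist}(x_{i-1},x_i)=d_i$ for $i>0$ and $\mathrm{dist}(x_{n-1},x_0)=d_0$. The set $\mathcal{AC}_n$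 is exactly the set of side length collections of cyclic $n$-gons, and a cyclic $n$-gon is determined up to isometry of $\mathbb{H}^2$ by its side length collection. For $\mathbf{d}\in\mathcal{AC}_n$, $D_0(\mathbf{d})$ is the hyperbolic area of the convex hull of a cyclic $n$-gon with side length collection $\mathbf{d}$. *)

theory Defs
  imports "HOL-Analysis.Analysis"
begin

text \<open>
  The hyperbolic plane of curvature \<open>-1\<close> is realised as the Beltrami--Klein model on the open
  unit disc of the complex plane, with its standard orientation.
\<close>

definition hyp_plane :: "complex set" where
  "hyp_plane = ball 0 1"

definition hyp_dist :: "complex \<Rightarrow> complex \<Rightarrow> real" where
  "hyp_dist z w =
     arcosh ((1 - inner z w) / (sqrt (1 - (norm z)\<^sup>2) * sqrt (1 - (norm w)\<^sup>2)))"

definition hyp_circle :: "complex \<Rightarrow> real \<Rightarrow> complex set" where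
  "hyp_circle c r = {z \<in> hyp_plane. hyp_dist c z = r}"

definition hyp_segment :: "complex \<Rightarrow> complex \<Rightarrow> complex set" where
  "hyp_segment z w = {u \<in> hyp_plane. hyp_dist z u + hyp_dist u w = hyp_dist z w}"

definition hyp_convex :: "complex set \<Rightarrow> bool" where
  "hyp_convex S \<longleftrightarrow> S \<subseteq> hyp_plane \<and> (\<forall>z\<in>S. \<forall>w\<in>S. hyp_segment z w \<subseteq> S)"

text \<open>
  The Klein metric has area element \<open>r dr d\<phi> / (1 - r\<^sup>2)\<^bsup>3/2\<^esup>\<close> in Euclidean polar coordinates.
\<close>

definition hyp_area :: "complex set \<Rightarrow> real" where
  "hyp_area S = (LINT z:S|lborel. 1 / sqrt (1 - (norm z)\<^sup>2) ^ 3)"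

text \<open>
  The half-open arc \<open>(a, b]\<close> run through counterclockwise from \<open>a\<close> to \<open>b\<close>, for points
  \<open>a\<close>, \<open>b\<close> of the circle with center \<open>c\<close> and radius \<open>r > 0\<close>.  Geodesic rays from \<open>c\<close> are Euclidean
  rays, and each meets the circle exactly once, so the counterclockwise order on the circle is that
  of the Euclidean angle at \<open>c\<close>, even though the Klein model is not conformal.
\<close>

definition ccw_arc :: "complex \<Rightarrow> real \<Rightarrow> complex \<Rightarrow> complex \<Rightarrow> complex set" where
  "ccw_arc c r a b =
     {p \<in> hyp_circle c r. 0 < Arg2pi ((p - c) / (a - c)) \<and>
        Arg2pi ((p - c) / (a - c)) \<le> Arg2pi ((b - c) / (a - c))}"

text \<open>
  Tuples indexed by \<open>0, \<dots>, n - 1\<close> are functions on \<open>nat\<close> of which only the values below \<open>n\<close> matter.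
\<close>

definition cyclic_ngon :: "nat \<Rightarrow> (nat \<Rightarrow> real) \<Rightarrow> (nat \<Rightarrow> complex) \<Rightarrow> bool" where
  "cyclic_ngon n d x \<longleftrightarrow>
     (\<exists>c\<in>hyp_plane. \<exists>r>0.
        (\<forall>i<n. x i \<in> hyp_circle c r) \<and>
        (\<forall>i\<in>{1..<n}. \<forall>j<n. j \<noteq> i \<longrightarrow> x j \<notin> ccw_arc c r (x (i - 1)) (x i))) \<and>
     (\<forall>i\<in>{1..<n}. hyp_dist (x (i - 1)) (x i) = d i) \<and>
     hyp_dist (x (n - 1)) (x 0) = d 0"

text \<open>
  All cyclic \<open>n\<close>-gons with the same side lengths are isometric, so the description below determines
  a value whenever such an \<open>n\<close>-gon exists; for other \<open>d\<close> the value is unspecified.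
\<close>

definition D0 :: "nat \<Rightarrow> (nat \<Rightarrow> real) \<Rightarrow> real" where
  "D0 n d = (THE A. \<exists>x. cyclic_ngon n d x \<and> A = hyp_area (hyp_convex hull (x ` {..<n})))"

definition \<theta> :: "real \<Rightarrow> real \<Rightarrow> real" where
  "\<theta> d J = 2 * arcsin (sinh (d / 2) / sinh J)"

definition C_set :: "nat \<Rightarrow> (nat \<Rightarrow> real) set" where
  "C_set n = {d. (\<forall>i<n. 0 < d i) \<and> (\<Sum>i<n. \<theta> (d i) (Max (d ` {..<n}) / 2)) > 2 * pi}"

definition BC_set :: "nat \<Rightarrow> (nat \<Rightarrow> real) set" where
  "BC_set n = {d. (\<forall>i<n. 0 < d i) \<and> (\<Sum>i<n. \<theta> (d i) (Max (d ` {..<n}) / 2)) = 2 * pi}"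

end

theory Submission
  imports Defs
begin

text \<open>
  Let \<open>J\<close> be the radius for which the central half angles \<open>arcsin (sinh (d\<^sub>i / 2) / sinh J)\<close> add
  up to \<open>pi\<close>.  For side lengths in \<open>C_set n \<union> BC_set n\<close> it exists, and every cyclic polygon with
  these sides has radius \<open>J\<close> and contains its center.  Cutting it into isosceles triangles at
  the center gives \<open>D0 n d = 2 * (\<Sum>\<^sub>i arcsin (tanh (d\<^sub>i / 2) / tanh J)) - 2 * pi\<close>.  This is a
  constrained expression; with the multiplier \<open>1 / cosh J\<close> on the angle sum, its derivative in \<open>J\<close>
  has the sign of the excess of the angle sum over \<open>pi\<close>, and its derivatives in the side lengths
  are positive, so the area increases along a path on which sides and radius grow while the angle
  sum stays at least \<open>pi\<close>.
\<close>

text \<open>The multiplier is found by differentiating in \<open>J\<close>. For every half side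
  \<open>w\<close> below \<open>J\<close>, the derivative of \<open>arcsin (tanh w / tanh J)\<close>
  is \<open>1 / cosh J\<close> times that of \<open>arcsin (sinh w / sinh J)\<close>, with the same
  factor for all \<open>w\<close>. Subtracting \<open>1 / cosh J\<close> times the angle sum cancels
  these derivatives at once and leaves only the derivative of the factor, multiplied by the excess
  of the angle sum over \<open>pi\<close>. For each given side collection with its own circumradius
  the excess is zero, so there the expression is the plain sum.

  The geometric effort comes from \<open>D0\<close> being a definite description: one cyclic polygon
  must be exhibited, and all of them, about any center, must be shown to have the same area. In the
  Klein model hyperbolic hulls are Euclidean ones, which makes the area computable about the center
  0; but the model is not conformal, so a motion taking a center to 0 needs a separate argument for
  the cyclic order.\<close>

section \<open>Monotonicity of the area function\<close>

lemma arcsin_strict_mono: "0 \<le> x \<Longrightarrow> x < y \<Longrightarrow> y \<le> 1 \<Longrightarrow> arcsin x < arcsin y"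
  by (simp add: arcsin_less_arcsin)

text \<open>One side's share of the constrained expression, without the constant \<open>pi\<close>
  of the constraint. Both minima become active together, for \<open>0 < t <= w\<close>, and the term
  then no longer depends on \<open>w\<close>.\<close>

definition excess_term :: "real \<Rightarrow> real \<Rightarrow> real" where
  "excess_term w t =
     arcsin (min 1 (tanh w / tanh t)) - arcsin (min 1 (sinh w / sinh t)) / cosh t"

text \<open>Both roots are multiples of the same
  \<open>sqrt ((sinh t)\<^sup>2 - (sinh w)\<^sup>2)\<close>; this is what makes the two arcsine
  derivatives comparable below.\<close>

lemma sqrt_one_minus_sinh_ratio:
  fixes w t :: real
  assumes "0 < w" "w < t"
  shows "sqrt (1 - (sinh w / sinh t)\<^sup>2) = sqrt ((sinh t)\<^sup>2 - (sinh w)\<^sup>2) / sinh t"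
    and "sqrt (1 - (tanh w / tanh t)\<^sup>2) = sqrt ((sinh t)\<^sup>2 - (sinh w)\<^sup>2) / (cosh w * sinh t)"
    and "0 < sqrt ((sinh t)\<^sup>2 - (sinh w)\<^sup>2)"
proof -
  have s: "0 < sinh t" "0 < sinh w" "sinh w < sinh t" using assms by auto
  then have "(sinh w)\<^sup>2 < (sinh t)\<^sup>2" by (intro power_strict_mono) auto
  then show "0 < sqrt ((sinh t)\<^sup>2 - (sinh w)\<^sup>2)" by simp
  have "1 - (sinh w / sinh t)\<^sup>2 = ((sinh t)\<^sup>2 - (sinh w)\<^sup>2) / (sinh t)\<^sup>2"
    using s by (simp add: field_simps power2_eq_square)
  then show "sqrt (1 - (sinh w / sinh t)\<^sup>2) = sqrt ((sinh t)\<^sup>2 - (sinh w)\<^sup>2) / sinh t"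
    using s by (simp add: real_sqrt_divide)
  have "1 - (tanh w / tanh t)\<^sup>2
      = ((sinh t)\<^sup>2 * (cosh w)\<^sup>2 - (sinh w)\<^sup>2 * (cosh t)\<^sup>2) / (cosh w * sinh t)\<^sup>2"
    using s by (simp add: tanh_def divide_simps)
  also have "\<dots> = ((sinh t)\<^sup>2 - (sinh w)\<^sup>2) / (cosh w * sinh t)\<^sup>2"
    by (simp add: cosh_square_eq algebra_simps)
  finally show "sqrt (1 - (tanh w / tanh t)\<^sup>2)
      = sqrt ((sinh t)\<^sup>2 - (sinh w)\<^sup>2) / (cosh w * sinh t)"
    using s by (simp add: real_sqrt_divide)
qed

lemma ratio_less_one:
  fixes w t :: real
  assumes "0 < w" "w < t"
  shows "0 < sinh w / sinh t" "sinh w / sinh t < 1" "0 < tanh w / tanh t" "tanh w / tanh t < 1"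
  using assms by (auto simp: divide_simps)

text \<open>For \<open>t > w\<close> the derivative of the first arcsine is
  \<open>1 / cosh t\<close> times that of the second, so the two cancel and only the derivative of
  the factor \<open>1 / cosh t\<close> is left. At \<open>t = w\<close> both arguments reach 1;
  these finitely many points are exempted when the derivative is integrated.\<close>

lemma has_derivative_excess_term:
  assumes "0 < w" "0 < t" "t \<noteq> w"
  shows "(excess_term w has_real_derivative
           sinh t / (cosh t)\<^sup>2 * arcsin (min 1 (sinh w / sinh t))) (at t)"
proof (cases "t < w")
  case True
  have ev: "(\<lambda>t. pi / 2 - pi / 2 / cosh t) x = excess_term w x" if "x \<in> {0<..<w}" for x
    using that by (simp add: excess_term_def min_def divide_simps)
  have "((\<lambda>t. pi / 2 - pi / 2 / cosh t) has_real_derivative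
           sinh t / (cosh t)\<^sup>2 * (pi / 2)) (at t)"
    by (auto intro!: derivative_eq_intros simp: power2_eq_square field_simps)
  then have "(excess_term w has_real_derivative sinh t / (cosh t)\<^sup>2 * (pi / 2)) (at t)"
    by (rule has_field_derivative_transform_within_open[where S="{0<..<w}"])
      (use True assms ev in auto)
  then show ?thesis
    using True assms by (simp add: min_def divide_simps)
next
  case False
  then have wt: "w < t" using assms by simp
  have ev: "arcsin (tanh w / tanh x) - arcsin (sinh w / sinh x) / cosh x = excess_term w x"
    if "x \<in> {w<..}" for x
    using that assms by (simp add: excess_term_def min_def divide_simps)
  define r where "r = sqrt ((sinh t)\<^sup>2 - (sinh w)\<^sup>2)"
  note q = sqrt_one_minus_sinh_ratio[OF assms(1) wt, folded r_def]
  note b = ratio_less_one[OF assms(1) wt]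
  have st: "0 < sinh t" "0 < tanh t" using assms by auto
  have d1: "((\<lambda>x. arcsin (tanh w / tanh x)) has_real_derivative
     inverse (sqrt (1 - (tanh w / tanh t)\<^sup>2)) * (- tanh w * (1 - (tanh t)\<^sup>2) / (tanh t)\<^sup>2)) (at t)"
    using b st by (auto intro!: derivative_eq_intros simp: power2_eq_square)
  have d2: "((\<lambda>x. arcsin (sinh w / sinh x) / cosh x) has_real_derivative
     (inverse (sqrt (1 - (sinh w / sinh t)\<^sup>2)) * (- sinh w * cosh t / (sinh t)\<^sup>2) * cosh t
       - arcsin (sinh w / sinh t) * sinh t) / (cosh t)\<^sup>2) (at t)"
    using b st by (auto intro!: derivative_eq_intros simp: power2_eq_square)
  have e1: "1 - (tanh t)\<^sup>2 = 1 / (cosh t)\<^sup>2"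
    by (simp add: tanh_def divide_simps) (simp add: cosh_square_eq)
  have f1: "inverse (sqrt (1 - (tanh w / tanh t)\<^sup>2)) * (- tanh w * (1 - (tanh t)\<^sup>2) / (tanh t)\<^sup>2)
     = - sinh w / (r * sinh t)"
    unfolding q e1 using st q(3) by (simp add: tanh_def divide_simps) (simp add: power2_eq_square)
  have f2: "(inverse (sqrt (1 - (sinh w / sinh t)\<^sup>2)) * (- sinh w * cosh t / (sinh t)\<^sup>2) * cosh t
       - arcsin (sinh w / sinh t) * sinh t) / (cosh t)\<^sup>2
     = - sinh w / (r * sinh t) - sinh t / (cosh t)\<^sup>2 * arcsin (sinh w / sinh t)"
    unfolding q using st q(3) by (simp add: divide_simps) (simp add: power2_eq_square algebra_simps)
  have "((\<lambda>x. arcsin (tanh w / tanh x) - arcsin (sinh w / sinh x) / cosh x) has_real_derivative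
      sinh t / (cosh t)\<^sup>2 * arcsin (sinh w / sinh t)) (at t)"
    using DERIV_diff[OF d1 d2] unfolding f1 f2 by simp
  then have "(excess_term w has_real_derivative sinh t / (cosh t)\<^sup>2 * arcsin (sinh w / sinh t)) (at t)"
    by (rule has_field_derivative_transform_within_open[where S="{w<..}"])
      (use wt ev in auto)
  then show ?thesis using b by (simp add: min_def)
qed

lemma continuous_on_angle:
  fixes w :: real
  assumes "0 < w"
  shows "continuous_on {0<..} (\<lambda>t. arcsin (min 1 (sinh w / sinh t)))"
proof -
  have "-1 \<le> sinh w / sinh t" if "0 < t" for t
  proof -
    have "0 \<le> sinh w / sinh t" using that assms by (intro divide_nonneg_nonneg) auto
    then show ?thesis by linarith
  qed
  then show ?thesis by (auto intro!: continuous_intros)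
qed

lemma continuous_on_excess_term:
  assumes "0 < w"
  shows "continuous_on {0<..} (excess_term w)"
proof -
  have "-1 \<le> tanh w / tanh t" if "0 < t" for t
  proof -
    have "0 \<le> tanh w / tanh t" using that assms by (intro divide_nonneg_nonneg) auto
    then show ?thesis by linarith
  qed
  then show ?thesis unfolding excess_term_def
    by (auto intro!: continuous_intros continuous_on_angle assms)
qed

text \<open>For \<open>x < t\<close> the first arcsine grows in the half side \<open>x\<close> at
  the rate \<open>cosh t / (r * cosh x)\<close>, with \<open>r\<close> the common root, while the
  second one divided by \<open>cosh t\<close> grows at the rate
  \<open>cosh x / (r * cosh t)\<close>. The case \<open>w = t\<close>, where \<open>r\<close>
  vanishes at the end, is reached by continuity.\<close>

lemma excess_term_mono:
  assumes "0 < v" "v \<le> w" "w \<le> t"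
  shows "excess_term v t \<le> excess_term w t"
proof (cases "v = w")
  case False
  then have vw: "v < w" using assms by simp
  have t: "0 < t" "0 < sinh t" "0 < tanh t" using assms by auto
  define g where "g = (\<lambda>x. arcsin (tanh x / tanh t) - arcsin (sinh x / sinh t) / cosh t)"
  have g: "excess_term x t = g x" if "x \<in> {v..w}" for x
  proof -
    have "tanh x / tanh t \<le> 1" "sinh x / sinh t \<le> 1" using that t assms by auto
    then show ?thesis by (simp add: excess_term_def g_def min.absorb2)
  qed
  have "g v < g w"
  proof (rule DERIV_pos_imp_increasing_open[OF vw])
    fix x assume x: "v < x" "x < w"
    then have xt: "0 < x" "x < t" using assms by auto
    define r where "r = sqrt ((sinh t)\<^sup>2 - (sinh x)\<^sup>2)"
    note q = sqrt_one_minus_sinh_ratio[OF xt, folded r_def]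
    note b = ratio_less_one[OF xt]
    have e1: "1 - (tanh x)\<^sup>2 = 1 / (cosh x)\<^sup>2"
      by (simp add: tanh_def divide_simps) (simp add: cosh_square_eq)
    have d: "(g has_real_derivative
       (inverse (sqrt (1 - (tanh x / tanh t)\<^sup>2)) * ((1 - (tanh x)\<^sup>2) / tanh t)
        - inverse (sqrt (1 - (sinh x / sinh t)\<^sup>2)) * (cosh x / sinh t) / cosh t)) (at x)"
      unfolding g_def using b t by (auto intro!: derivative_eq_intros)
    have e: "inverse (sqrt (1 - (tanh x / tanh t)\<^sup>2)) * ((1 - (tanh x)\<^sup>2) / tanh t)
        - inverse (sqrt (1 - (sinh x / sinh t)\<^sup>2)) * (cosh x / sinh t) / cosh t
        = ((cosh t)\<^sup>2 - (cosh x)\<^sup>2) / (r * cosh x * cosh t)"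
      unfolding q e1 using t q(3)
      by (simp add: tanh_def divide_simps) (simp add: power2_eq_square algebra_simps)
    have "cosh x < cosh t" using xt by (simp add: cosh_real_nonneg_less_iff)
    then have "(cosh x)\<^sup>2 < (cosh t)\<^sup>2" by (intro power_strict_mono) auto
    then have "0 < ((cosh t)\<^sup>2 - (cosh x)\<^sup>2) / (r * cosh x * cosh t)" using q(3) by simp
    then show "\<exists>y. (g has_real_derivative y) (at x) \<and> 0 < y"
      using d unfolding e by blast
  next
    have "-1 \<le> tanh x / tanh t \<and> tanh x / tanh t \<le> 1 \<and> -1 \<le> sinh x / sinh t \<and> sinh x / sinh t \<le> 1"
      if "x \<in> {v..w}" for x
    proof -
      have "0 \<le> tanh x / tanh t" "0 \<le> sinh x / sinh t"
        using that t assms by (auto intro!: divide_nonneg_nonneg)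
      moreover have "tanh x / tanh t \<le> 1" "sinh x / sinh t \<le> 1" using that t assms by auto
      ultimately show ?thesis by linarith
    qed
    then show "continuous_on {v..w} g" unfolding g_def using t
      by (auto intro!: continuous_intros)
  qed
  then show ?thesis using g assms by simp
qed simp

lemma angle_antimono:
  fixes w :: real
  assumes "0 < w" "0 < s" "s \<le> t"
  shows "arcsin (min 1 (sinh w / sinh t)) \<le> arcsin (min 1 (sinh w / sinh s))"
proof -
  have "0 < sinh s" "sinh s \<le> sinh t" "0 < sinh w" using assms by auto
  then have "sinh w / sinh t \<le> sinh w / sinh s" "0 \<le> sinh w / sinh t"
    by (auto intro: divide_left_mono)
  then show ?thesis by (intro arcsin_le_arcsin) auto
qed

lemma angle_strict_antimono:
  fixes w :: real
  assumes "0 < w" "0 < s" "s < t" "w < t"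
  shows "arcsin (min 1 (sinh w / sinh t)) < arcsin (min 1 (sinh w / sinh s))"
proof -
  have p: "0 < sinh s" "sinh s < sinh t" "0 < sinh w" "sinh w < sinh t" using assms by auto
  then have "sinh w / sinh t < sinh w / sinh s" "0 \<le> sinh w / sinh t" "sinh w / sinh t < 1"
    by (auto intro: divide_strict_left_mono)
  then show ?thesis by (intro arcsin_strict_mono) auto
qed

text \<open>
  \<open>J\<close> and \<open>J'\<close> are the circumradii.  The minima in \<open>excess_term (w' i) t\<close> truncate the half sides
  \<open>w' i\<close> to the radius \<open>t\<close>.  Replacing \<open>w i\<close> by \<open>min (w' i) J\<close> and then letting \<open>t\<close> run from
  \<open>J\<close> to \<open>J'\<close> is a path that keeps the sum of the half angles at least \<open>pi\<close>; on the
  straight path from \<open>w\<close> to \<open>w'\<close>, polygons need not contain their centers.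
\<close>

lemma sum_arcsin_tanh_less:
  fixes w w' :: "nat \<Rightarrow> real"
  assumes n: "3 \<le> n"
    and w: "\<And>i. i < n \<Longrightarrow> 0 < w i \<and> w i \<le> w' i \<and> w i \<le> J \<and> w' i \<le> J'"
    and strict: "k < n" "w k < w' k"
    and J: "0 < J" "(\<Sum>i<n. arcsin (sinh (w i) / sinh J)) = pi"
    and J': "0 < J'" "(\<Sum>i<n. arcsin (sinh (w' i) / sinh J')) = pi"
  shows "(\<Sum>i<n. arcsin (tanh (w i) / tanh J)) < (\<Sum>i<n. arcsin (tanh (w' i) / tanh J'))"
proof -
  define A where "A = (\<lambda>t. \<Sum>i<n. arcsin (min 1 (sinh (w' i) / sinh t)))"
  \<comment> \<open>The constrained expression for the sides \<open>w'\<close> truncated to the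
    radius \<open>t\<close>. At \<open>J'\<close> nothing is truncated and the angle sum is
    \<open>pi\<close>, so it is the sum for \<open>w'\<close>; at \<open>J\<close> it bounds the sum
    for \<open>w\<close> from above.\<close>
  define \<Psi> where "\<Psi> = (\<lambda>t. (\<Sum>i<n. excess_term (w' i) t) + pi / cosh t)"
  have w'0: "0 < w' i" if "i < n" for i using w[OF that] by simp
  \<comment> \<open>With a radius that does not grow, no angle would shrink and the angle of side
    \<open>k\<close> would grow, so the two angle sums could not both be \<open>pi\<close>.\<close>
  have JJ: "J < J'"
  proof (rule ccontr)
    assume "\<not> J < J'"
    then have "J' \<le> J" by simp
    have "(\<Sum>i<n. arcsin (sinh (w i) / sinh J)) < (\<Sum>i<n. arcsin (sinh (w' i) / sinh J'))"
    proof (rule sum_strict_mono_ex1)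
      have le: "sinh (w i) / sinh J \<le> sinh (w' i) / sinh J'" if "i < n" for i
        using w[OF that] J' J \<open>J' \<le> J\<close> by (intro frac_le) auto
      have b: "0 \<le> sinh (w i) / sinh J" "sinh (w' i) / sinh J' \<le> 1" if "i < n" for i
        using w[OF that] J' J by auto
      show "\<forall>i\<in>{..<n}. arcsin (sinh (w i) / sinh J) \<le> arcsin (sinh (w' i) / sinh J')"
      proof
        fix i assume "i \<in> {..<n}"
        then show "arcsin (sinh (w i) / sinh J) \<le> arcsin (sinh (w' i) / sinh J')"
          using le[of i] b[of i] by (intro arcsin_le_arcsin) auto
      qed
      have "sinh (w k) / sinh J < sinh (w' k) / sinh J'"
        using w[OF strict(1)] strict J' J \<open>J' \<le> J\<close> by (intro frac_less) auto
      then have "arcsin (sinh (w k) / sinh J) < arcsin (sinh (w' k) / sinh J')"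
        using b[OF strict(1)] by (intro arcsin_strict_mono) auto
      then show "\<exists>i\<in>{..<n}. arcsin (sinh (w i) / sinh J) < arcsin (sinh (w' i) / sinh J')"
        using strict by auto
    qed simp
    then show False using J J' by simp
  qed
  have J'_eq: "arcsin (min 1 (sinh (w' i) / sinh J')) = arcsin (sinh (w' i) / sinh J')"
    "arcsin (min 1 (tanh (w' i) / tanh J')) = arcsin (tanh (w' i) / tanh J')" if "i < n" for i
    using w[OF that] J' by (auto simp: min_def)
  have J_eq: "arcsin (min 1 (sinh (w i) / sinh J)) = arcsin (sinh (w i) / sinh J)"
    "arcsin (min 1 (tanh (w i) / tanh J)) = arcsin (tanh (w i) / tanh J)" if "i < n" for i
    using w[OF that] J by (auto simp: min_def)
  have AJ': "A J' = pi"
    using J' J'_eq by (simp add: A_def)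
  have end': "\<Psi> J' = (\<Sum>i<n. arcsin (tanh (w' i) / tanh J'))"
    using J' J'_eq
    by (simp add: \<Psi>_def excess_term_def sum_subtractf flip: sum_divide_distrib)
  have start: "(\<Sum>i<n. arcsin (tanh (w i) / tanh J)) = (\<Sum>i<n. excess_term (w i) J) + pi / cosh J"
    using J J_eq
    by (simp add: excess_term_def sum_subtractf flip: sum_divide_distrib)
  have "(\<Sum>i<n. excess_term (w i) J) \<le> (\<Sum>i<n. excess_term (w' i) J)"
  proof (rule sum_mono)
    fix i assume "i \<in> {..<n}"
    then have i: "i < n" by simp
    have "excess_term (w i) J \<le> excess_term (min (w' i) J) J"
      using w[OF i] by (intro excess_term_mono) auto
    also have "\<dots> = excess_term (w' i) J"
      using J by (auto simp: min_def excess_term_def divide_simps)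
    finally show "excess_term (w i) J \<le> excess_term (w' i) J" .
  qed
  then have first: "(\<Sum>i<n. arcsin (tanh (w i) / tanh J)) \<le> \<Psi> J"
    by (simp add: start \<Psi>_def)
  define D where "D = (\<lambda>t. sinh t / (cosh t)\<^sup>2 * (A t - pi))"
  have sub: "{J..J'} \<subseteq> {0<..}" using J by auto
  have "(D has_integral (\<Psi> J' - \<Psi> J)) {J..J'}"
  \<comment> \<open>The exceptional points are the radii at which the truncation of some side
    stops.\<close>
  proof (rule fundamental_theorem_of_calculus_interior_strong[where S="w' ` {..<n}"])
    fix x assume x: "x \<in> {J<..<J'} - w' ` {..<n}"
    then have "0 < x" using J by auto
    have d: "(excess_term (w' i) has_real_derivative
           sinh x / (cosh x)\<^sup>2 * arcsin (min 1 (sinh (w' i) / sinh x))) (at x)" if "i \<in> {..<n}" for i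
      using that x \<open>0 < x\<close> w'0 by (intro has_derivative_excess_term) auto
    have "(\<Psi> has_real_derivative
        (\<Sum>i<n. sinh x / (cosh x)\<^sup>2 * arcsin (min 1 (sinh (w' i) / sinh x)))
        + - pi * sinh x / (cosh x)\<^sup>2) (at x)"
      unfolding \<Psi>_def
      by (intro DERIV_add DERIV_sum d) (auto intro!: derivative_eq_intros simp: power2_eq_square)
    also have "(\<Sum>i<n. sinh x / (cosh x)\<^sup>2 * arcsin (min 1 (sinh (w' i) / sinh x)))
        + - pi * sinh x / (cosh x)\<^sup>2 = D x"
      by (simp add: D_def A_def sum_distrib_left right_diff_distrib)
    finally show "(\<Psi> has_vector_derivative D x) (at x)"
      by (simp add: has_real_derivative_iff_has_vector_derivative)
  next
    show "continuous_on {J..J'} \<Psi>" unfolding \<Psi>_def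
      by (intro continuous_intros continuous_on_subset[OF continuous_on_excess_term sub])
        (auto simp: w'0)
  qed (use JJ in auto)
  then have int: "integral {J..J'} D = \<Psi> J' - \<Psi> J" by (rule integral_unique)
  have cont: "continuous_on {J..J'} D" unfolding D_def A_def
    by (intro continuous_intros continuous_on_subset[OF continuous_on_angle sub])
      (auto simp: w'0)
  have Age: "pi \<le> A t" if "J \<le> t" "t \<le> J'" for t
    unfolding AJ'[symmetric] A_def using that J w'0 by (intro sum_mono angle_antimono) auto
  have Dge: "0 \<le> D t" if "t \<in> {J..J'}" for t
    using that Age[of t] J by (simp add: D_def)
  \<comment> \<open>Strictness needs a half side below \<open>J'\<close>: its angle really decreases
    between \<open>J\<close> and \<open>J'\<close>, so the angle sum exceeds \<open>pi\<close> at
    \<open>J\<close>. If all half sides were equal to \<open>J'\<close>, the sum would be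
    \<open>n * (pi / 2)\<close>, too large for \<open>n >= 3\<close>.\<close>
  have "\<exists>i<n. w' i < J'"
  proof (rule ccontr)
    assume "\<not> ?thesis"
    then have "w' i = J'" if "i < n" for i using w[OF that] that by force
    then have "(\<Sum>i<n. arcsin (sinh (w' i) / sinh J')) = (\<Sum>i<n. pi / 2)"
      using J' by (intro sum.cong) auto
    then have "real n * (pi / 2) = pi" using J' by simp
    then show False using n by simp
  qed
  then obtain m where m: "m < n" "w' m < J'" by auto
  have "A J' < A J" unfolding A_def
  proof (rule sum_strict_mono_ex1)
    show "\<forall>i\<in>{..<n}. arcsin (min 1 (sinh (w' i) / sinh J')) \<le> arcsin (min 1 (sinh (w' i) / sinh J))"
      using J JJ w'0 by (auto intro!: angle_antimono)
    show "\<exists>i\<in>{..<n}. arcsin (min 1 (sinh (w' i) / sinh J')) < arcsin (min 1 (sinh (w' i) / sinh J))"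
      using J JJ w'0 m by (auto intro!: angle_strict_antimono)
  qed simp
  then have "0 < D J" using J AJ' by (simp add: D_def)
  then have "integral {J..J'} D \<noteq> 0"
    using integral_eq_0_iff[OF cont JJ Dge] JJ by force
  moreover have "0 \<le> integral {J..J'} D"
    by (rule integral_nonneg[OF integrable_continuous_real[OF cont] Dge])
  ultimately show ?thesis using int first end' by linarith
qed

text \<open>With \<open>c = pi / 2 / B > 1\<close> the claim comes down to
  \<open>sin a / sin B < sin (c * a)\<close>. Since \<open>sin (c * B) = 1\<close>, it is enough
  that \<open>sin (c * x) / sin x\<close> decreases up to \<open>B\<close>. The numerator
  \<open>N\<close> of its derivative vanishes at 0 and has the negative derivative
  \<open>(1 - c\<^sup>2) * (sin (c * x) * sin x)\<close>.\<close>

lemma arcsin_sin_ratio_less: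
  assumes "0 < a" "a < B" "B < pi / 2"
  shows "arcsin (sin a / sin B) < a * (pi / 2 / B)"
proof -
  define c where "c = pi / 2 / B"
  have B: "0 < B" using assms by simp
  have c: "1 < c" "c * B = pi / 2" using assms B by (auto simp: c_def)
  have cx: "0 < c * x \<and> c * x \<le> pi / 2 \<and> 0 < x \<and> x < pi / 2" if "0 < x" "x \<le> B" for x
  proof -
    have "c * x \<le> c * B" using that c by (intro mult_left_mono) auto
    then show ?thesis using that c assms by auto
  qed
  define N where "N = (\<lambda>x. c * cos (c * x) * sin x - sin (c * x) * cos x)"
  have N: "N x < 0" if x: "0 < x" "x \<le> B" for x
  proof -
    have "N 0 > N x"
    proof (rule DERIV_neg_imp_decreasing_open[OF x(1)])
      fix y assume y: "0 < y" "y < x"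
      have "(N has_real_derivative (1 - c\<^sup>2) * (sin (c * y) * sin y)) (at y)"
        unfolding N_def
        by (auto intro!: derivative_eq_intros simp: power2_eq_square algebra_simps)
      moreover have "0 < sin (c * y) * sin y"
        using cx[of y] y x c by (intro mult_pos_pos sin_gt_zero) (auto intro: mult_pos_pos)
      moreover have "1 - c\<^sup>2 < 0" using c power_strict_mono[of 1 c 2] by simp
      ultimately show "\<exists>z. (N has_real_derivative z) (at y) \<and> z < 0"
        by (intro exI[of _ "(1 - c\<^sup>2) * (sin (c * y) * sin y)"]) (simp add: mult_neg_pos)
    qed (auto simp: N_def intro!: continuous_intros)
    then show ?thesis by (simp add: N_def)
  qed
  have sx: "0 < sin x" if "0 < x" "x \<le> B" for x
    using cx[OF that] by (intro sin_gt_zero) auto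
  have "sin (c * a) / sin a > sin (c * B) / sin B"
  proof (rule DERIV_neg_imp_decreasing_open[OF assms(2)])
    fix x assume x: "a < x" "x < B"
    have "((\<lambda>x. sin (c * x) / sin x) has_real_derivative N x / (sin x)\<^sup>2) (at x)"
      using sx[of x] x assms unfolding N_def
      by (auto intro!: derivative_eq_intros simp: power2_eq_square algebra_simps)
    moreover have "N x / (sin x)\<^sup>2 < 0"
      using N[of x] sx[of x] x assms by (simp add: divide_neg_pos)
    ultimately show "\<exists>y. ((\<lambda>x. sin (c * x) / sin x) has_real_derivative y) (at x) \<and> y < 0"
      by blast
  next
    show "continuous_on {a..B} (\<lambda>x. sin (c * x) / sin x)"
    proof (intro continuous_intros ballI)
      show "sin x \<noteq> 0" if "x \<in> {a..B}" for x using sx[of x] that assms by auto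
    qed
  qed
  then have "sin a / sin B < sin (c * a)"
    using sx[of a] sx[of B] assms B by (simp add: c(2)) (simp add: field_simps)
  moreover have "0 \<le> sin a / sin B" using sx[of a] sx[of B] assms B by simp
  ultimately have "arcsin (sin a / sin B) < arcsin (sin (c * a))"
    by (intro arcsin_strict_mono) auto
  also have "\<dots> = c * a" using cx[of a] assms by (intro arcsin_sin) auto
  finally show ?thesis by (simp add: c_def mult.commute)
qed

text \<open>Intermediate values of the angle sum between \<open>D\<close>, where it is at least
  \<open>pi\<close> by assumption, and \<open>K\<close>, chosen with
  \<open>sinh D / sinh K = sin (pi / n)\<close> so that each of the \<open>n\<close> angles is at
  most \<open>pi / n\<close>.\<close>

lemma exists_circumradius:
  fixes w :: "nat \<Rightarrow> real"
  assumes "2 \<le> n" "0 < D" "\<And>i. i < n \<Longrightarrow> 0 < w i \<and> w i \<le> D"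
    and "pi \<le> (\<Sum>i<n. arcsin (sinh (w i) / sinh D))"
  shows "\<exists>J\<ge>D. (\<Sum>i<n. arcsin (sinh (w i) / sinh J)) = pi"
proof -
  have sn: "0 < sin (pi / n)" "pi / n \<le> pi / 2"
    using assms(1) by (auto intro!: sin_gt_zero simp: field_simps)
  define K where "K = arsinh (sinh D / sin (pi / n))"
  have sD: "0 < sinh D" using assms by simp
  have K: "sinh K = sinh D / sin (pi / n)" by (simp add: K_def)
  have "sinh D * sin (pi / n) \<le> sinh D * 1" using sD by (intro mult_left_mono) auto
  then have "sinh D \<le> sinh K"
    using sn by (simp add: K pos_le_divide_eq)
  then have DK: "D \<le> K" by simp
  have b: "0 < sinh (w i) / sinh t" "sinh (w i) / sinh t \<le> 1" if "i < n" "D \<le> t" for i t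
    using assms(2) assms(3)[OF that(1)] that by (auto intro!: divide_pos_pos)
  have "\<exists>J. D \<le> J \<and> J \<le> K \<and> (\<Sum>i<n. arcsin (sinh (w i) / sinh J)) = pi"
  proof (rule IVT2')
    have "arcsin (sinh (w i) / sinh K) \<le> pi / n" if "i < n" for i
    proof -
      have "sinh (w i) / sinh K \<le> sinh D / sinh K"
        using assms(3)[OF that] DK assms(2) by (intro divide_right_mono) auto
      also have "\<dots> = sin (pi / n)" using sD sn by (simp add: K)
      finally have "arcsin (sinh (w i) / sinh K) \<le> arcsin (sin (pi / n))"
        using b[OF that DK] by (intro arcsin_le_arcsin) auto
      also have "\<dots> = pi / n" using sn by (intro arcsin_sin) (auto intro: order_trans[of _ 0])
      finally show ?thesis .
    qed
    then have "(\<Sum>i<n. arcsin (sinh (w i) / sinh K)) \<le> (\<Sum>i<n. pi / n)" by (intro sum_mono) auto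
    then show "(\<Sum>i<n. arcsin (sinh (w i) / sinh K)) \<le> pi" using assms(1) by simp
    have "-1 \<le> sinh (w i) / sinh t" if "i < n" "D \<le> t" for i t
      using b[OF that] by linarith
    then show "continuous_on {D..K} (\<lambda>J. \<Sum>i<n. arcsin (sinh (w i) / sinh J))"
      using b assms(2) by (auto intro!: continuous_intros)
  qed (use assms DK in auto)
  then show ?thesis by auto
qed

section \<open>Geodesics, convexity and distances in the Klein model\<close>

text \<open>The left side is the Gram determinant of the vectors (1, z), (1, u), (1, w) for the
  Lorentz form \<open>1 - inner\<close>, hence the square of the determinant of these vectors, which
  is twice the signed Euclidean area of the triangle.\<close>

lemma gram_klein_det_real:
  fixes z1 z2 u1 u2 w1 w2 :: real
  shows "(1 - (z1\<^sup>2 + z2\<^sup>2)) * (1 - (u1\<^sup>2 + u2\<^sup>2)) * (1 - (w1\<^sup>2 + w2\<^sup>2)) +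
     2 * (1 - (z1 * u1 + z2 * u2)) * (1 - (u1 * w1 + u2 * w2)) * (1 - (z1 * w1 + z2 * w2)) -
     (1 - (z1 * u1 + z2 * u2))\<^sup>2 * (1 - (w1\<^sup>2 + w2\<^sup>2)) -
     (1 - (u1 * w1 + u2 * w2))\<^sup>2 * (1 - (z1\<^sup>2 + z2\<^sup>2)) -
     (1 - (z1 * w1 + z2 * w2))\<^sup>2 * (1 - (u1\<^sup>2 + u2\<^sup>2)) =
     ((z1 - u1) * (w2 - u2) + (u2 - z2) * (w1 - u1))\<^sup>2"
  by algebra

lemma gram_klein_det:
  fixes z u w :: complex
  defines "a \<equiv> 1 - inner z u" and "b \<equiv> 1 - inner u w" and "c \<equiv> 1 - inner z w"
    and "p \<equiv> 1 - (norm z)\<^sup>2" and "q \<equiv> 1 - (norm u)\<^sup>2" and "r \<equiv> 1 - (norm w)\<^sup>2"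
  shows "p * q * r + 2 * a * b * c - a\<^sup>2 * r - b\<^sup>2 * p - c\<^sup>2 * q = (Im (cnj (z - u) * (w - u)))\<^sup>2"
  using gram_klein_det_real[of "Re z" "Im z" "Re u" "Im u" "Re w" "Im w"]
  unfolding assms inner_complex_def cmod_power2 by simp

lemma hyp_plane_iff: "z \<in> hyp_plane \<longleftrightarrow> 0 < 1 - (norm z)\<^sup>2"
  by (simp add: hyp_plane_def abs_square_less_1)

lemmas klein_norm_pos = hyp_plane_iff[THEN iffD1]

text \<open>Reverse Cauchy-Schwarz inequality for the Lorentz form; it puts the argument of
  \<open>arcosh\<close> in \<open>hyp_dist\<close> into the range where \<open>arcosh\<close>
  inverts \<open>cosh\<close>.\<close>

lemma klein_reverse_Cauchy:
  assumes "z \<in> hyp_plane" "u \<in> hyp_plane"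
  shows "1 \<le> (1 - inner z u) / (sqrt (1 - (norm z)\<^sup>2) * sqrt (1 - (norm u)\<^sup>2))"
proof -
  note p = klein_norm_pos[OF assms(1)] klein_norm_pos[OF assms(2)]
  have "(1 - inner z u)\<^sup>2 - (1 - (norm z)\<^sup>2) * (1 - (norm u)\<^sup>2)
      = (norm (z - u))\<^sup>2 * (1 - (norm z)\<^sup>2) + (inner z (z - u))\<^sup>2"
    unfolding inner_complex_def cmod_power2
    by (simp add: power2_eq_square algebra_simps)
  also have "\<dots> \<ge> 0" using p by simp
  finally have "(1 - (norm z)\<^sup>2) * (1 - (norm u)\<^sup>2) \<le> (1 - inner z u)\<^sup>2" by simp
  moreover have "\<bar>inner z u\<bar> < 1"
  proof -
    have "\<bar>inner z u\<bar> \<le> norm z * norm u" by (rule Cauchy_Schwarz_ineq2)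
    also have "\<dots> < 1" using assms mult_strict_mono[of "norm z" 1 "norm u" 1]
      by (auto simp: hyp_plane_def)
    finally show ?thesis .
  qed
  ultimately have "sqrt ((1 - (norm z)\<^sup>2) * (1 - (norm u)\<^sup>2)) \<le> 1 - inner z u"
    by (intro real_le_lsqrt) auto
  then show ?thesis using p by (simp add: real_sqrt_mult)
qed

text \<open>Let \<open>A\<close>, \<open>B\<close>, \<open>C\<close> be the hyperbolic cosines of
  the three distances. The addition theorem of \<open>cosh\<close> turns equality in the triangle
  inequality into \<open>C - A * B = sqrt ((A\<^sup>2 - 1) * (B\<^sup>2 - 1))\<close>. Squared, the
  two sides differ by a multiple of the Gram determinant, so equality means collinearity; the sign
  of \<open>C - A * B\<close> remains as the second condition.\<close>

lemma hyp_dist_add_eq_iff: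
  assumes "z \<in> hyp_plane" "u \<in> hyp_plane" "w \<in> hyp_plane"
  shows "hyp_dist z u + hyp_dist u w = hyp_dist z w \<longleftrightarrow>
     Im (cnj (z - u) * (w - u)) = 0 \<and>
     (1 - inner z u) * (1 - inner u w) \<le> (1 - inner z w) * (1 - (norm u)\<^sup>2)"
proof -
  define a b c where "a = 1 - inner z u" and "b = 1 - inner u w" and "c = 1 - inner z w"
  define p q r where "p = 1 - (norm z)\<^sup>2" and "q = 1 - (norm u)\<^sup>2" and "r = 1 - (norm w)\<^sup>2"
  define A B C where "A = a / (sqrt p * sqrt q)" and "B = b / (sqrt q * sqrt r)"
    and "C = c / (sqrt p * sqrt r)"
  have pos: "0 < p" "0 < q" "0 < r" using klein_norm_pos assms by (auto simp: p_def q_def r_def)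
  have one: "1 \<le> A" "1 \<le> B" "1 \<le> C"
    using klein_reverse_Cauchy assms
    by (auto simp: A_def B_def C_def a_def b_def c_def p_def q_def r_def)
  define d where "d = Im (cnj (z - u) * (w - u))"
  have A2: "A\<^sup>2 = a\<^sup>2 / (p * q)" and B2: "B\<^sup>2 = b\<^sup>2 / (q * r)"
    using pos by (auto simp: A_def B_def power_divide power_mult_distrib)
  have CAB: "C - A * B = (c * q - a * b) / (q * (sqrt p * sqrt r))"
  proof -
    have "A * B = a * b / (q * (sqrt p * sqrt r))"
      using pos by (simp add: A_def B_def)
    then show ?thesis using pos by (simp add: C_def diff_divide_distrib)
  qed
  have CAB2: "(C - A * B)\<^sup>2 = (c * q - a * b)\<^sup>2 / (q\<^sup>2 * (p * r))"
    unfolding CAB using pos by (simp add: power_divide power_mult_distrib)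
  have "(A\<^sup>2 - 1) * (B\<^sup>2 - 1) - (C - A * B)\<^sup>2
      = ((a\<^sup>2 - p * q) * (b\<^sup>2 - q * r) - (c * q - a * b)\<^sup>2) / (q\<^sup>2 * (p * r))"
    unfolding CAB2 A2 B2 using pos
    by (simp add: divide_simps) (simp add: power2_eq_square algebra_simps)
  also have "(a\<^sup>2 - p * q) * (b\<^sup>2 - q * r) - (c * q - a * b)\<^sup>2
      = q * (p * q * r + 2 * a * b * c - a\<^sup>2 * r - b\<^sup>2 * p - c\<^sup>2 * q)"
    by algebra
  also have "p * q * r + 2 * a * b * c - a\<^sup>2 * r - b\<^sup>2 * p - c\<^sup>2 * q = d\<^sup>2"
    using gram_klein_det[of z u w] unfolding a_def b_def c_def p_def q_def r_def d_def by simp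
  also have "q * d\<^sup>2 / (q\<^sup>2 * (p * r)) = d\<^sup>2 / (q * (p * r))"
    using pos by (simp add: power2_eq_square)
  finally have gram: "(A\<^sup>2 - 1) * (B\<^sup>2 - 1) - (C - A * B)\<^sup>2 = d\<^sup>2 / (q * (p * r))" .
  have h: "hyp_dist z u = arcosh A" "hyp_dist u w = arcosh B" "hyp_dist z w = arcosh C"
    by (auto simp: hyp_dist_def A_def B_def C_def a_def b_def c_def p_def q_def r_def)
  have "arcosh A + arcosh B = arcosh C \<longleftrightarrow> cosh (arcosh A + arcosh B) = cosh (arcosh C)"
    using one by (simp del: cosh_arcosh_real)
  also have "\<dots> \<longleftrightarrow> C - A * B = sqrt ((A\<^sup>2 - 1) * (B\<^sup>2 - 1))"
    using one by (auto simp: cosh_add sinh_arcosh_real real_sqrt_mult)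
  also have "\<dots> \<longleftrightarrow> (A\<^sup>2 - 1) * (B\<^sup>2 - 1) = (C - A * B)\<^sup>2 \<and> 0 \<le> C - A * B"
  proof
    assume *: "C - A * B = sqrt ((A\<^sup>2 - 1) * (B\<^sup>2 - 1))"
    have "0 \<le> (A\<^sup>2 - 1) * (B\<^sup>2 - 1)" using one by (intro mult_nonneg_nonneg) auto
    then show "(A\<^sup>2 - 1) * (B\<^sup>2 - 1) = (C - A * B)\<^sup>2 \<and> 0 \<le> C - A * B"
      unfolding * by simp
  next
    assume "(A\<^sup>2 - 1) * (B\<^sup>2 - 1) = (C - A * B)\<^sup>2 \<and> 0 \<le> C - A * B"
    then show "C - A * B = sqrt ((A\<^sup>2 - 1) * (B\<^sup>2 - 1))" by simp
  qed
  also have "\<dots> \<longleftrightarrow> d = 0 \<and> a * b \<le> c * q"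
  proof -
    have "0 \<le> C - A * B \<longleftrightarrow> a * b \<le> c * q"
    proof -
      have "0 < q * (sqrt p * sqrt r)" using pos by simp
      then show ?thesis unfolding CAB by (simp add: zero_le_divide_iff)
    qed
    moreover have "(A\<^sup>2 - 1) * (B\<^sup>2 - 1) = (C - A * B)\<^sup>2 \<longleftrightarrow> d = 0"
      using gram pos by auto
    ultimately show ?thesis by simp
  qed
  finally show ?thesis unfolding h a_def b_def c_def q_def d_def by simp
qed

text \<open>The reason for working in the Klein model: hyperbolic convexity becomes Euclidean
  convexity.\<close>

lemma hyp_segment_eq_closed_segment:
  assumes z: "z \<in> hyp_plane" and w: "w \<in> hyp_plane"
  shows "hyp_segment z w = closed_segment z w"
proof
  \<comment> \<open>With \<open>u\<close> as base point of the line and \<open>v\<close> nonzero,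
    the second condition of \<open>hyp_dist_add_eq_iff\<close> becomes
    \<open>\<tau> * \<sigma> <= 0\<close>, which puts \<open>u\<close> between \<open>z\<close> and
    \<open>w\<close>.\<close>
  have key: "(1 - inner z w) * (1 - (norm u)\<^sup>2) - (1 - inner z u) * (1 - inner u w)
      = - \<tau> * \<sigma> * ((norm v)\<^sup>2 * (1 - (norm u)\<^sup>2) + (inner u v)\<^sup>2)"
    if "z - u = \<tau> *\<^sub>R v" "w - u = \<sigma> *\<^sub>R v" for u v \<tau> \<sigma>
  proof -
    have "z = u + \<tau> *\<^sub>R v" "w = u + \<sigma> *\<^sub>R v" using that by (auto simp: algebra_simps)
    then show ?thesis unfolding inner_complex_def cmod_power2
      by (simp add: power2_eq_square algebra_simps)
  qed
  show "hyp_segment z w \<subseteq> closed_segment z w"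
  proof
    fix u assume "u \<in> hyp_segment z w"
    then have u: "u \<in> hyp_plane" and e: "hyp_dist z u + hyp_dist u w = hyp_dist z w"
      by (auto simp: hyp_segment_def)
    note e = e[unfolded hyp_dist_add_eq_iff[OF z u w]]
    show "u \<in> closed_segment z w"
    proof (cases "u = w")
      case False
      define v where "v = w - u"
      have v: "0 < (norm v)\<^sup>2" using False by (simp add: v_def)
      define \<tau> where "\<tau> = inner v (z - u) / (norm v)\<^sup>2"
      have "(norm v)\<^sup>2 *\<^sub>R (z - u) = inner v (z - u) *\<^sub>R v"
      proof -
        define s where "s = z - u"
        define K where "K = Re s * Im v - Im s * Re v"
        have K: "K = 0" using e by (simp add: K_def v_def s_def algebra_simps)
        have "((Re v)\<^sup>2 + (Im v)\<^sup>2) * Re s = (Re v * Re s + Im v * Im s) * Re v + Im v * K"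
          "((Re v)\<^sup>2 + (Im v)\<^sup>2) * Im s = (Re v * Re s + Im v * Im s) * Im v - Re v * K"
          unfolding K_def by (simp_all add: power2_eq_square algebra_simps)
        then have "((Re v)\<^sup>2 + (Im v)\<^sup>2) * Re s = (Re v * Re s + Im v * Im s) * Re v"
          "((Re v)\<^sup>2 + (Im v)\<^sup>2) * Im s = (Re v * Re s + Im v * Im s) * Im v"
          unfolding K by (simp_all only: mult_zero_right add_0_right diff_zero)
        then show ?thesis
          unfolding s_def[symmetric] cmod_power2 complex_eq_iff inner_complex_def scaleR_complex.sel
          by (rule conjI)
      qed
      then have "(1 / (norm v)\<^sup>2) *\<^sub>R ((norm v)\<^sup>2 *\<^sub>R (z - u)) = (1 / (norm v)\<^sup>2) *\<^sub>R (inner v (z - u) *\<^sub>R v)"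
        by (rule arg_cong)
      then have zu: "z - u = \<tau> *\<^sub>R v"
        using v by (simp add: \<tau>_def)
      define X where "X = (norm v)\<^sup>2 * (1 - (norm u)\<^sup>2) + (inner u v)\<^sup>2"
      have "w - u = 1 *\<^sub>R v" by (simp add: v_def)
      from key[OF zu this] have "\<tau> * X \<le> 0" using e unfolding X_def by linarith
      moreover have "0 < X" unfolding X_def
        using v klein_norm_pos[OF u] by (intro add_pos_nonneg) auto
      ultimately have \<tau>: "\<tau> \<le> 0" using mult_pos_pos[of \<tau> X] by linarith
      define t where "t = - \<tau> / (1 - \<tau>)"
      have "(1 - \<tau>) *\<^sub>R u = z - \<tau> *\<^sub>R w"
        using zu by (simp add: v_def algebra_simps)
      then have "(1 / (1 - \<tau>)) *\<^sub>R ((1 - \<tau>) *\<^sub>R u) = (1 / (1 - \<tau>)) *\<^sub>R (z - \<tau> *\<^sub>R w)"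
        by (rule arg_cong)
      then have "u = (1 / (1 - \<tau>)) *\<^sub>R (z - \<tau> *\<^sub>R w)"
        using \<tau> by simp
      also have "\<dots> = (1 - t) *\<^sub>R z + t *\<^sub>R w"
      proof -
        have "1 - t = 1 / (1 - \<tau>)" using \<tau> by (simp add: t_def field_simps)
        then show ?thesis by (simp add: t_def scaleR_diff_right)
      qed
      finally have "u = (1 - t) *\<^sub>R z + t *\<^sub>R w" .
      moreover have "0 \<le> t" "t \<le> 1" using \<tau> by (auto simp: t_def divide_simps)
      ultimately show ?thesis by (auto simp: in_segment)
    qed simp
  qed
  show "closed_segment z w \<subseteq> hyp_segment z w"
  proof
    fix u assume us: "u \<in> closed_segment z w"
    have "convex hyp_plane" by (simp add: hyp_plane_def)
    then have u: "u \<in> hyp_plane"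
      using us z w unfolding convex_contains_segment by blast
    obtain t where t: "0 \<le> t" "t \<le> 1" "u = (1 - t) *\<^sub>R z + t *\<^sub>R w"
      using us by (auto simp: in_segment)
    have d: "z - u = (- t) *\<^sub>R (w - z)" "w - u = (1 - t) *\<^sub>R (w - z)"
      using t by (auto simp: algebra_simps)
    have "Im (cnj (z - u) * (w - u)) = 0" unfolding d by (simp add: algebra_simps)
    moreover have "0 \<le> - (- t) * (1 - t) * ((norm (w - z))\<^sup>2 * (1 - (norm u)\<^sup>2) + (inner u (w - z))\<^sup>2)"
      using t klein_norm_pos[OF u] by auto
    ultimately show "u \<in> hyp_segment z w"
      using key[OF d] u hyp_dist_add_eq_iff[OF z u w] by (simp add: hyp_segment_def)
  qed
qed

lemma hyp_convex_iff: "hyp_convex S \<longleftrightarrow> S \<subseteq> hyp_plane \<and> convex S"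
proof (cases "S \<subseteq> hyp_plane")
  case True
  then have "\<forall>z\<in>S. \<forall>w\<in>S. hyp_segment z w = closed_segment z w"
    using hyp_segment_eq_closed_segment by (simp add: subset_iff)
  then show ?thesis using True by (simp add: hyp_convex_def convex_contains_segment)
qed (simp add: hyp_convex_def)

lemma hyp_convex_hull_eq:
  assumes "X \<subseteq> hyp_plane"
  shows "hyp_convex hull X = convex hull X"
proof
  have "convex hull X \<subseteq> hyp_plane"
    using assms by (intro hull_minimal) (auto simp: hyp_plane_def)
  then show "hyp_convex hull X \<subseteq> convex hull X"
    using hyp_convex_iff[of "convex hull X"] by (intro hull_minimal hull_subset) (simp add: convex_convex_hull)
  show "convex hull X \<subseteq> hyp_convex hull X"
  proof (rule hull_minimal)
    show "X \<subseteq> hyp_convex hull X" by (rule hull_subset)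
    show "convex (hyp_convex hull X)"
      unfolding hull_def
    proof (rule convex_Inter)
      show "convex S" if "S \<in> {T. hyp_convex T \<and> X \<subseteq> T}" for S
        using that hyp_convex_iff[of S] by simp
    qed
  qed
qed

section \<open>Circles about the origin and distances along them\<close>

lemma hyp_dist_self: "z \<in> hyp_plane \<Longrightarrow> hyp_dist z z = 0"
  using klein_norm_pos[of z] by (simp add: hyp_dist_def dot_square_norm)

lemma one_minus_tanh_square: "1 - (tanh r)\<^sup>2 = 1 / (cosh r)\<^sup>2" for r :: real
  by (simp add: tanh_def divide_simps) (simp add: cosh_square_eq)

lemma hyp_circle_0:
  assumes "0 < r"
  shows "hyp_circle 0 r = {z. norm z = tanh r}"
proof -
  have *: "hyp_dist 0 z = arcosh (1 / sqrt (1 - (norm z)\<^sup>2))" for z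
    by (simp add: hyp_dist_def)
  have "hyp_dist 0 z = r" if "norm z = tanh r" for z
    using that assms by (simp add: * one_minus_tanh_square real_sqrt_divide arcosh_cosh_real)
  moreover have "z \<in> hyp_plane" if "norm z = tanh r" for z
    using that tanh_real_lt_1[of r] by (simp add: hyp_plane_def)
  moreover have "norm z = tanh r" if z: "z \<in> hyp_plane" "hyp_dist 0 z = r" for z
  proof -
    define m where "m = 1 - (norm z)\<^sup>2"
    have m: "0 < m" "m \<le> 1" using klein_norm_pos[OF z(1)] by (auto simp: m_def)
    then have "1 \<le> 1 / sqrt m" by simp
    then have "cosh r = 1 / sqrt m"
      using z(2) cosh_arcosh_real[of "1 / sqrt m"] by (simp add: * flip: m_def)
    then have "1 - (tanh r)\<^sup>2 = m" using m by (simp add: one_minus_tanh_square power_divide)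
    then show ?thesis using assms by (simp add: m_def power2_eq_iff_nonneg)
  qed
  ultimately show ?thesis by (auto simp: hyp_circle_def)
qed

text \<open>In an isosceles triangle with legs \<open>r\<close>, the hyperbolic sine of half the
  base is \<open>sinh r\<close> times the sine of half the apex angle. This is where the ratios
  \<open>sinh (d / 2) / sinh J\<close> in \<open>\<theta>\<close> come from.\<close>

lemma hyp_dist_on_circle:
  "hyp_dist (complex_of_real (tanh r) * cis \<alpha>) (complex_of_real (tanh r) * cis \<beta>)
    = 2 * arsinh (\<bar>sinh r * sin ((\<beta> - \<alpha>) / 2)\<bar>)" (is "hyp_dist ?z ?w = _")
proof -
  define s where "s = sinh r * sin ((\<beta> - \<alpha>) / 2)"
  have c: "cos (\<beta> - \<alpha>) = 1 - 2 * (sin ((\<beta> - \<alpha>) / 2))\<^sup>2"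
    using cos_double_sin[of "(\<beta> - \<alpha>) / 2"] by (simp only: mult_2 field_sum_of_halves)
  have i: "inner ?z ?w = (tanh r)\<^sup>2 * cos (\<beta> - \<alpha>)"
    by (simp add: inner_complex_def cos_diff power2_eq_square algebra_simps)
  have n: "(norm ?z)\<^sup>2 = (tanh r)\<^sup>2" "(norm ?w)\<^sup>2 = (tanh r)\<^sup>2" by (simp_all add: norm_mult)
  have "hyp_dist ?z ?w = arcosh ((1 - (tanh r)\<^sup>2 * cos (\<beta> - \<alpha>)) * (cosh r)\<^sup>2)"
    unfolding hyp_dist_def i n one_minus_tanh_square
    by (simp add: real_sqrt_divide power2_eq_square)
  also have "(1 - (tanh r)\<^sup>2 * cos (\<beta> - \<alpha>)) * (cosh r)\<^sup>2 = 1 + 2 * s\<^sup>2"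
  proof -
    have "(tanh r)\<^sup>2 * (cosh r)\<^sup>2 = (sinh r)\<^sup>2" by (simp add: tanh_def power_divide)
    then show ?thesis using hyperbolic_pythagoras[of r] unfolding c s_def power_mult_distrib by algebra
  qed
  also have "\<dots> = cosh (2 * arsinh \<bar>s\<bar>)"
    by (simp add: cosh_double cosh_arsinh_real)
  also have "arcosh \<dots> = 2 * arsinh \<bar>s\<bar>"
    using arsinh_real_neg_iff[of "\<bar>s\<bar>"] by (intro arcosh_cosh_real) linarith
  finally show ?thesis by (simp add: s_def)
qed

section \<open>The hyperbolic area measure and its invariance\<close>

lemma borel_measurable_Complex [measurable (raw)]:
  assumes [measurable]: "f \<in> borel_measurable M" "g \<in> borel_measurable M"
  shows "(\<lambda>x. Complex (f x) (g x)) \<in> borel_measurable M"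
proof -
  have "(\<lambda>x. Complex (f x) (g x)) = (\<lambda>x. complex_of_real (f x) + \<i> * complex_of_real (g x))"
    by (auto simp: complex_eq_iff)
  then show ?thesis by simp
qed

text \<open>Lebesgue measure on \<open>complex\<close> comes from the Euclidean space structure;
  comparing boxes identifies it with the product of two line measures, so that integrals can be
  iterated.\<close>

lemma distr_lborel_Complex: "distr lborel lborel (\<lambda>(x, y). Complex x y) = (lborel :: complex measure)"
proof (rule lborel_eqI[symmetric])
  fix l u :: complex
  have m: "(\<lambda>(x, y). Complex x y) \<in> measurable (lborel :: (real \<times> real) measure) lborel"
    by (simp add: split_beta borel_prod[symmetric])
  have v: "(\<lambda>(x, y). Complex x y) -` box l u = box (Re l, Im l) (Re u, Im u)"
    by (auto simp: in_box_complex_iff box_prod)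
  show "emeasure (distr lborel lborel (\<lambda>(x, y). Complex x y)) (box l u) = (\<Prod>b\<in>Basis. (u - l) \<bullet> b)"
    if "\<And>b. b \<in> Basis \<Longrightarrow> l \<bullet> b \<le> u \<bullet> b"
  proof -
    have le: "Re l \<le> Re u" "Im l \<le> Im u" using that[of 1] that[of \<i>] by (auto simp: Basis_complex_def)
    have "emeasure (distr lborel lborel (\<lambda>(x, y). Complex x y)) (box l u)
       = emeasure lborel (box (Re l, Im l) (Re u, Im u))"
      by (subst emeasure_distr[OF m]) (auto simp: v)
    also have "box (Re l, Im l) (Re u, Im u) = box (Re l) (Re u) \<times> box (Im l) (Im u)"
      by (auto simp: box_prod)
    also have "emeasure lborel \<dots> = emeasure lborel (box (Re l) (Re u)) * emeasure lborel (box (Im l) (Im u))"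
      by (subst lborel_prod[symmetric]) (simp add: lborel.emeasure_pair_measure_Times)
    also have "\<dots> = (\<Prod>b\<in>Basis. (u - l) \<bullet> b)"
      using le by (simp add: Basis_complex_def ennreal_mult)
    finally show ?thesis .
  qed
qed simp

lemma nn_integral_complex:
  assumes [measurable]: "f \<in> borel_measurable borel"
  shows "(\<integral>\<^sup>+z. f z \<partial>(lborel :: complex measure)) = (\<integral>\<^sup>+x. \<integral>\<^sup>+y. f (Complex x y) \<partial>lborel \<partial>lborel)"
    and "(\<integral>\<^sup>+z. f z \<partial>(lborel :: complex measure)) = (\<integral>\<^sup>+y. \<integral>\<^sup>+x. f (Complex x y) \<partial>lborel \<partial>lborel)"
proof -
  have m: "(\<lambda>(x, y). Complex x y) \<in> measurable (lborel :: (real \<times> real) measure) lborel"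
    by (simp add: split_beta borel_prod[symmetric])
  have "(\<integral>\<^sup>+z. f z \<partial>(lborel :: complex measure)) = (\<integral>\<^sup>+z. f (case z of (x, y) \<Rightarrow> Complex x y) \<partial>(lborel \<Otimes>\<^sub>M lborel))"
    by (subst distr_lborel_Complex[symmetric], subst nn_integral_distr[OF m]) (simp_all add: lborel_prod)
  also have "\<dots> = (\<integral>\<^sup>+x. \<integral>\<^sup>+y. f (Complex x y) \<partial>lborel \<partial>lborel)"
    by (subst lborel.nn_integral_fst[symmetric]) (simp_all add: split_beta)
  finally show 1: "(\<integral>\<^sup>+z. f z \<partial>(lborel :: complex measure)) = (\<integral>\<^sup>+x. \<integral>\<^sup>+y. f (Complex x y) \<partial>lborel \<partial>lborel)" .
  show "(\<integral>\<^sup>+z. f z \<partial>(lborel :: complex measure)) = (\<integral>\<^sup>+y. \<integral>\<^sup>+x. f (Complex x y) \<partial>lborel \<partial>lborel)"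
    unfolding 1 by (rule lborel_pair.Fubini') (simp add: split_beta)
qed

text \<open>A rotation is split into two affine substitutions in one real variable: first
  \<open>q * x + p * y\<close> for fixed \<open>x\<close>, then \<open>(x - q * y) / p\<close> for
  fixed \<open>y\<close>. Their scaling factors are inverse to each other. Dividing by
  \<open>p\<close> is what forces \<open>Re u\<close> to be nonzero.\<close>

lemma nn_integral_rotate_aux:
  fixes u :: complex
  assumes u: "norm u = 1" "Re u \<noteq> 0" and [measurable]: "g \<in> borel_measurable borel"
  shows "(\<integral>\<^sup>+z. g (u * z) \<partial>lborel) = (\<integral>\<^sup>+z. g z \<partial>lborel)"
proof -
  define p q where "p = Re u" and "q = Im u"
  have p: "p \<noteq> 0" and pq: "p * p + q * q = 1"
    using u cmod_power2[of u] by (auto simp: p_def q_def power2_eq_square)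
  have U: "u * Complex x y = Complex (p * x - q * y) (q * x + p * y)" for x y
    by (simp add: complex_eq_iff p_def q_def)
  have e: "(x - q * (q * x + p * y)) / p = p * x - q * y" for x y
  proof -
    have "x - q * (q * x + p * y) = (1 - q * q) * x - p * q * y" by (simp add: algebra_simps)
    also have "1 - q * q = p * p" using pq by simp
    finally show ?thesis using p by (simp add: field_simps)
  qed
  have s1: "(\<integral>\<^sup>+y. g (Complex ((x - q * y) / p) y) \<partial>lborel)
      = \<bar>p\<bar> * (\<integral>\<^sup>+y. g (Complex (p * x - q * y) (q * x + p * y)) \<partial>lborel)" for x
    by (subst nn_integral_real_affine[OF _ p, of _ "q * x"]) (simp_all add: e)
  have s2: "(\<integral>\<^sup>+x. g (Complex x y) \<partial>lborel)
      = \<bar>1 / p\<bar> * (\<integral>\<^sup>+x. g (Complex ((x - q * y) / p) y) \<partial>lborel)" for y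
    using p by (subst nn_integral_real_affine[of _ "1 / p" "- q * y / p"]) (simp_all add: diff_divide_distrib)
  have "\<bar>p\<bar> * (\<integral>\<^sup>+z. g (u * z) \<partial>lborel) = (\<integral>\<^sup>+x. \<bar>p\<bar> * (\<integral>\<^sup>+y. g (u * Complex x y) \<partial>lborel) \<partial>lborel)"
    by (subst nn_integral_complex(1)) (simp_all add: nn_integral_cmult)
  also have "\<dots> = (\<integral>\<^sup>+x. \<integral>\<^sup>+y. g (Complex ((x - q * y) / p) y) \<partial>lborel \<partial>lborel)"
    unfolding U by (simp add: s1)
  also have "\<dots> = (\<integral>\<^sup>+y. \<integral>\<^sup>+x. g (Complex ((x - q * y) / p) y) \<partial>lborel \<partial>lborel)"
    by (rule lborel_pair.Fubini') (simp add: split_beta)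
  also have "\<dots> = (\<integral>\<^sup>+y. \<bar>p\<bar> * (\<integral>\<^sup>+x. g (Complex x y) \<partial>lborel) \<partial>lborel)"
    unfolding s2 using p by (simp add: mult.assoc[symmetric] ennreal_mult[symmetric])
  also have "\<dots> = \<bar>p\<bar> * (\<integral>\<^sup>+z. g z \<partial>lborel)"
    by (subst nn_integral_complex(2)) (simp_all add: nn_integral_cmult)
  finally have eq: "\<bar>p\<bar> * (\<integral>\<^sup>+z. g (u * z) \<partial>lborel) = \<bar>p\<bar> * (\<integral>\<^sup>+z. g z \<partial>lborel)" .
  show ?thesis
    using eq p by (simp add: ennreal_mult_cancel_left)
qed

lemma nn_integral_rotate:
  fixes u :: complex
  assumes u: "norm u = 1" and g[measurable]: "g \<in> borel_measurable borel"
  shows "(\<integral>\<^sup>+z. g (u * z) \<partial>lborel) = (\<integral>\<^sup>+z. g z \<partial>lborel)"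
proof (cases "Re u = 0")
  case True
  \<comment> \<open>A quarter turn is done as two rotations by a square root of \<open>u\<close>,
    whose real part is not zero.\<close>
  define v where "v = csqrt u"
  have v: "v * v = u" by (simp add: v_def flip: power2_eq_square)
  then have "norm v * norm v = 1" using u by (metis norm_mult)
  then have nv: "norm v = 1" by (metis norm_ge_zero real_sqrt_abs2 real_sqrt_one abs_of_nonneg)
  have "Re v \<noteq> 0"
  proof
    assume "Re v = 0"
    then have "Im u = 0" using v by (auto simp: complex_eq_iff)
    then show False using True u by (simp add: complex_eq_iff cmod_def)
  qed
  then have "(\<integral>\<^sup>+z. g (v * (v * z)) \<partial>lborel) = (\<integral>\<^sup>+z. g z \<partial>lborel)"
    using nn_integral_rotate_aux[OF nv, of "\<lambda>z. g (v * z)"] nn_integral_rotate_aux[OF nv, of g] by simp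
  then show ?thesis by (simp add: v flip: mult.assoc)
qed (use nn_integral_rotate_aux assms in auto)

definition hyp_density :: "complex \<Rightarrow> ennreal" where
  "hyp_density z = ennreal (1 / sqrt (1 - (norm z)\<^sup>2) ^ 3) * indicator hyp_plane z"

text \<open>The measure behind \<open>hyp_area\<close>. With values in \<open>ennreal\<close>,
  invariance under motions can be proved by substitution in nonnegative integrals, without
  integrability conditions.\<close>

definition hyp_measure :: "complex measure" where
  "hyp_measure = density lborel hyp_density"

lemma hyp_plane_borel [measurable]: "hyp_plane \<in> sets borel"
  by (simp add: hyp_plane_def)

lemma hyp_density_borel [measurable]: "hyp_density \<in> borel_measurable borel"
  unfolding hyp_density_def by measurable

lemma sets_hyp_measure [simp, measurable_cong]: "sets hyp_measure = sets borel"
  and space_hyp_measure [simp]: "space hyp_measure = UNIV"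
  by (simp_all add: hyp_measure_def)

lemma nn_integral_hyp_measure:
  "g \<in> borel_measurable borel \<Longrightarrow> (\<integral>\<^sup>+z. g z \<partial>hyp_measure) = (\<integral>\<^sup>+z. hyp_density z * g z \<partial>lborel)"
  unfolding hyp_measure_def by (subst nn_integral_density) auto

lemma hyp_area_eq_measure:
  assumes S: "S \<in> sets borel" "S \<subseteq> hyp_plane"
  shows "hyp_area S = measure hyp_measure S"
proof -
  have "hyp_area S = enn2real (\<integral>\<^sup>+z. ennreal (indicator S z *\<^sub>R (1 / sqrt (1 - (norm z)\<^sup>2) ^ 3)) \<partial>lborel)"
    unfolding hyp_area_def set_lebesgue_integral_def
  proof (rule integral_eq_nn_integral)
    show "(\<lambda>z. indicator S z *\<^sub>R (1 / sqrt (1 - (norm z)\<^sup>2) ^ 3)) \<in> borel_measurable lborel"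
      using S by measurable
    show "AE z in lborel. 0 \<le> indicat_real S z *\<^sub>R (1 / sqrt (1 - (norm z)\<^sup>2) ^ 3)"
      using S(2) by (intro AE_I2) (auto simp: indicator_def hyp_plane_def abs_square_le_1 split: if_splits)
  qed
  also have "(\<integral>\<^sup>+z. ennreal (indicator S z *\<^sub>R (1 / sqrt (1 - (norm z)\<^sup>2) ^ 3)) \<partial>lborel)
      = (\<integral>\<^sup>+z. hyp_density z * indicator S z \<partial>lborel)"
    using S(2) by (intro nn_integral_cong) (auto simp: hyp_density_def indicator_def)
  also have "\<dots> = emeasure hyp_measure S"
    using S by (simp add: hyp_measure_def emeasure_density)
  finally show ?thesis by (simp add: measure_def)
qed

text \<open>By injectivity on the disc, the indicator of the image composed with \<open>f\<close> is
  there the indicator of \<open>S\<close>; outside the disc the density vanishes.\<close>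

lemma hyp_area_image:
  assumes f: "f \<in> borel_measurable borel" "inj_on f hyp_plane" "f ` hyp_plane \<subseteq> hyp_plane"
    and inv: "\<And>g. g \<in> borel_measurable borel \<Longrightarrow> (\<integral>\<^sup>+z. g (f z) \<partial>hyp_measure) = (\<integral>\<^sup>+z. g z \<partial>hyp_measure)"
    and S: "S \<in> sets borel" "S \<subseteq> hyp_plane" "f ` S \<in> sets borel"
  shows "hyp_area (f ` S) = hyp_area S"
proof -
  have [measurable]: "f \<in> borel_measurable borel" by (rule f)
  have [measurable]: "f ` S \<in> sets borel" "S \<in> sets borel" by (fact S)+
  have "emeasure hyp_measure (f ` S) = (\<integral>\<^sup>+z. indicator (f ` S) z \<partial>hyp_measure)" by simp
  also have "\<dots> = (\<integral>\<^sup>+z. indicator (f ` S) (f z) \<partial>hyp_measure)" by (subst inv) auto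
  also have "\<dots> = (\<integral>\<^sup>+z. hyp_density z * indicator (f ` S) (f z) \<partial>lborel)"
    by (subst nn_integral_hyp_measure) auto
  also have "\<dots> = (\<integral>\<^sup>+z. hyp_density z * indicator S z \<partial>lborel)"
  proof (intro nn_integral_cong)
    fix z
    show "hyp_density z * indicator (f ` S) (f z) = hyp_density z * indicator S z"
    proof (cases "z \<in> hyp_plane")
      case True
      then have "f z \<in> f ` S \<longleftrightarrow> z \<in> S" using f(2) S(2) by (simp add: inj_on_image_mem_iff)
      then show ?thesis by (auto simp: indicator_def)
    qed (simp add: hyp_density_def)
  qed
  also have "\<dots> = emeasure hyp_measure S" by (simp add: hyp_measure_def emeasure_density)
  finally have "emeasure hyp_measure (f ` S) = emeasure hyp_measure S" .
  moreover have "f ` S \<subseteq> hyp_plane" using f(3) S(2) by blast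
  ultimately show ?thesis using S by (simp add: hyp_area_eq_measure measure_def)
qed

lemma nn_integral_hyp_measure_rotate:
  assumes "norm u = 1" and [measurable]: "g \<in> borel_measurable borel"
  shows "(\<integral>\<^sup>+z. g (u * z) \<partial>hyp_measure) = (\<integral>\<^sup>+z. g z \<partial>hyp_measure)"
proof -
  have "hyp_density (u * z) = hyp_density z" for z
    using assms(1) by (simp add: hyp_density_def hyp_plane_def norm_mult indicator_def)
  then have "(\<integral>\<^sup>+z. g (u * z) \<partial>hyp_measure) = (\<integral>\<^sup>+z. hyp_density (u * z) * g (u * z) \<partial>lborel)"
    by (simp add: nn_integral_hyp_measure)
  also have "\<dots> = (\<integral>\<^sup>+z. hyp_density z * g z \<partial>lborel)"
    by (rule nn_integral_rotate[OF assms(1)]) auto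
  finally show ?thesis by (simp add: nn_integral_hyp_measure)
qed

text \<open>For real \<open>c\<close> in the unit interval, the translation along the real axis taking \<open>c\<close> to \<open>0\<close>.\<close>

definition boost :: "real \<Rightarrow> complex \<Rightarrow> complex" where
  "boost c z = Complex ((Re z - c) / (1 - c * Re z)) (sqrt (1 - c\<^sup>2) * Im z / (1 - c * Re z))"

lemma boost_borel [measurable]: "boost c \<in> borel_measurable borel"
  unfolding boost_def by measurable

lemma one_minus_mult_pos:
  fixes c x :: real
  assumes "\<bar>c\<bar> < 1" "\<bar>x\<bar> \<le> 1"
  shows "0 < 1 - c * x"
proof -
  have "c * x \<le> \<bar>c\<bar> * \<bar>x\<bar>" by (metis abs_ge_self abs_mult)
  also have "\<dots> \<le> \<bar>c\<bar> * 1" using assms by (intro mult_left_mono) auto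
  finally show ?thesis using assms by simp
qed

lemma Re_hyp_plane: "z \<in> hyp_plane \<Longrightarrow> \<bar>Re z\<bar> < 1"
  using abs_Re_le_cmod[of z] by (simp add: hyp_plane_def)

text \<open>The vector (1, \<open>boost c z\<close>), multiplied by
  \<open>(1 - c * Re z) / sqrt (1 - c\<^sup>2)\<close>, is the image of (1, z) under a Lorentz
  boost. The Lorentz form \<open>1 - inner\<close> is invariant under the boost, so only these
  factors remain.\<close>

lemma boost_inner:
  assumes c: "\<bar>c\<bar> < 1" and z: "\<bar>Re z\<bar> \<le> 1" and w: "\<bar>Re w\<bar> \<le> 1"
  shows "1 - inner (boost c z) (boost c w)
    = (1 - c\<^sup>2) * (1 - inner z w) / ((1 - c * Re z) * (1 - c * Re w))"
proof -
  note p = one_minus_mult_pos[OF c z] one_minus_mult_pos[OF c w]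
  have k: "sqrt (1 - c\<^sup>2) * sqrt (1 - c\<^sup>2) = 1 - c\<^sup>2" using c by (simp add: abs_square_le_1)
  have "inner (boost c z) (boost c w)
      = ((Re z - c) * (Re w - c) + (sqrt (1 - c\<^sup>2) * sqrt (1 - c\<^sup>2)) * (Im z * Im w))
        / ((1 - c * Re z) * (1 - c * Re w))"
    by (simp add: boost_def inner_complex_def add_divide_distrib ac_simps)
  then have "1 - inner (boost c z) (boost c w)
      = ((1 - c * Re z) * (1 - c * Re w) - ((Re z - c) * (Re w - c) + (1 - c\<^sup>2) * (Im z * Im w)))
        / ((1 - c * Re z) * (1 - c * Re w))"
    unfolding k using p by (simp add: diff_divide_distrib)
  also have "(1 - c * Re z) * (1 - c * Re w) - ((Re z - c) * (Re w - c) + (1 - c\<^sup>2) * (Im z * Im w))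
      = (1 - c\<^sup>2) * (1 - inner z w)"
    unfolding inner_complex_def inner_real_def by algebra
  finally show ?thesis .
qed

lemma boost_norm:
  assumes c: "\<bar>c\<bar> < 1" and z: "\<bar>Re z\<bar> \<le> 1"
  shows "1 - (norm (boost c z))\<^sup>2 = (1 - c\<^sup>2) * (1 - (norm z)\<^sup>2) / (1 - c * Re z)\<^sup>2"
  using boost_inner[OF c z z] unfolding power2_norm_eq_inner by (simp add: power2_eq_square)

lemma boost_in_hyp_plane_iff:
  assumes c: "\<bar>c\<bar> < 1" and z: "\<bar>Re z\<bar> \<le> 1"
  shows "boost c z \<in> hyp_plane \<longleftrightarrow> z \<in> hyp_plane"
proof -
  have "0 < (1 - c\<^sup>2)" "0 < (1 - c * Re z)\<^sup>2"
    using one_minus_mult_pos[OF c z] c by (auto simp: abs_square_less_1)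
  then show ?thesis unfolding hyp_plane_iff boost_norm[OF c z]
    by (simp add: zero_less_divide_iff zero_less_mult_iff)
qed

text \<open>The cube is the Jacobian of \<open>boost c\<close>. With \<open>\<kappa>\<close> for the
  quotient, the real part has derivative \<open>\<kappa>\<^sup>2\<close> in \<open>Re z\<close> and
  does not depend on \<open>Im z\<close>, and the imaginary part has derivative
  \<open>\<kappa>\<close> in \<open>Im z\<close>.\<close>

lemma hyp_density_boost:
  assumes c: "\<bar>c\<bar> < 1" and z: "\<bar>Re z\<bar> \<le> 1"
  shows "hyp_density z = hyp_density (boost c z) * ennreal ((sqrt (1 - c\<^sup>2) / (1 - c * Re z)) ^ 3)"
proof (cases "z \<in> hyp_plane")
  case True
  have p: "0 < 1 - c * Re z" "0 < 1 - (norm z)\<^sup>2" "0 < 1 - c\<^sup>2"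
    using one_minus_mult_pos[OF c z] True c by (auto simp: hyp_plane_iff abs_square_less_1)
  have s: "sqrt (1 - (norm (boost c z))\<^sup>2) = sqrt (1 - c\<^sup>2) * sqrt (1 - (norm z)\<^sup>2) / (1 - c * Re z)"
    unfolding boost_norm[OF c z] using p by (simp add: real_sqrt_divide real_sqrt_mult)
  have "1 / sqrt (1 - (norm (boost c z))\<^sup>2) ^ 3 * (sqrt (1 - c\<^sup>2) / (1 - c * Re z)) ^ 3
      = 1 / sqrt (1 - (norm z)\<^sup>2) ^ 3"
    unfolding s using p by (simp add: power_divide power_mult_distrib)
  moreover have "0 \<le> 1 / sqrt (1 - (norm (boost c z))\<^sup>2) ^ 3"
    unfolding s using p by simp
  ultimately show ?thesis using True p boost_in_hyp_plane_iff[OF c z]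
    by (simp add: hyp_density_def ennreal_mult[symmetric] del: divide_const_simps)
qed (simp add: hyp_density_def boost_in_hyp_plane_iff[OF c z])

text \<open>The Jacobian is triangular, so two substitutions in one variable suffice: a linear one
  in the imaginary part, then \<open>X\<close> in the real part.\<close>

lemma nn_integral_hyp_measure_boost:
  assumes c: "\<bar>c\<bar> < 1" and [measurable]: "g \<in> borel_measurable borel"
  shows "(\<integral>\<^sup>+z. g (boost c z) \<partial>hyp_measure) = (\<integral>\<^sup>+z. g z \<partial>hyp_measure)"
proof -
  define G where "G = (\<lambda>z. hyp_density z * g z)"
  have [measurable]: "G \<in> borel_measurable borel" unfolding G_def by measurable
  define \<kappa> where "\<kappa> = (\<lambda>x. sqrt (1 - c\<^sup>2) / (1 - c * x))"
  define X where "X = (\<lambda>x. (x - c) / (1 - c * x))"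
  define H where "H = (\<lambda>x. \<integral>\<^sup>+y. G (Complex x y) \<partial>lborel)"
  have [measurable]: "H \<in> borel_measurable borel" unfolding H_def by measurable
  have c2: "0 < 1 - c\<^sup>2" using c by (simp add: abs_square_less_1)
  have outside: "hyp_density (Complex x y) = 0" if "x \<notin> {-1..1}" for x y
    using that Re_hyp_plane[of "Complex x y"] by (auto simp: hyp_density_def indicator_def)
  have inner: "(\<integral>\<^sup>+y. hyp_density (Complex x y) * g (boost c (Complex x y)) \<partial>lborel)
      = H (X x) * ennreal ((1 - c\<^sup>2) / (1 - c * x)\<^sup>2) * indicator {-1..1} x" for x
  proof (cases "x \<in> {-1..1}")
    case True
    then have x: "\<bar>x\<bar> \<le> 1" by auto
    have \<kappa>: "0 < \<kappa> x" using one_minus_mult_pos[OF c x] c2 by (simp add: \<kappa>_def)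
    have b: "boost c (Complex x y) = Complex (X x) (\<kappa> x * y)" for y
      by (simp add: boost_def X_def \<kappa>_def)
    have "(\<integral>\<^sup>+y. hyp_density (Complex x y) * g (boost c (Complex x y)) \<partial>lborel)
        = (\<integral>\<^sup>+y. ennreal (\<kappa> x ^ 3) * G (Complex (X x) (\<kappa> x * y)) \<partial>lborel)"
      using hyp_density_boost[OF c, of "Complex x _"] x
      by (intro nn_integral_cong) (simp add: b G_def \<kappa>_def[symmetric] ac_simps, simp add: \<kappa>_def ac_simps)
    also have "\<dots> = ennreal ((\<kappa> x)\<^sup>2) * (ennreal (\<kappa> x) * (\<integral>\<^sup>+y. G (Complex (X x) (\<kappa> x * y)) \<partial>lborel))"
      using \<kappa> by (simp add: nn_integral_cmult ennreal_mult[symmetric] mult.assoc[symmetric]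
          power2_eq_square power3_eq_cube)
    also have "ennreal (\<kappa> x) * (\<integral>\<^sup>+y. G (Complex (X x) (\<kappa> x * y)) \<partial>lborel) = H (X x)"
      unfolding H_def using \<kappa>
      by (subst nn_integral_real_affine[where c="\<kappa> x" and t=0 and f="\<lambda>y. G (Complex (X x) y)"]) auto
    also have "(\<kappa> x)\<^sup>2 = (1 - c\<^sup>2) / (1 - c * x)\<^sup>2"
      using c2 by (simp add: \<kappa>_def power_divide)
    finally show ?thesis using True by (simp add: ac_simps)
  qed (simp add: outside)
  have pos: "0 < 1 - c * x" if "x \<in> {-1..1}" for x using one_minus_mult_pos[OF c] that by auto
  \<comment> \<open>\<open>X\<close> fixes both ends of the interval \<open>{-1..1}\<close>, outside
    of which the density vanishes; so the substitution can be made on a compact interval.\<close>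
  have X1: "X (-1) = -1" "X 1 = 1" using pos[of 1] pos[of "-1"] by (auto simp: X_def field_simps)
  have "(\<integral>\<^sup>+z. g (boost c z) \<partial>hyp_measure) = (\<integral>\<^sup>+z. hyp_density z * g (boost c z) \<partial>lborel)"
    by (simp add: nn_integral_hyp_measure)
  also have "\<dots> = (\<integral>\<^sup>+x. \<integral>\<^sup>+y. hyp_density (Complex x y) * g (boost c (Complex x y)) \<partial>lborel \<partial>lborel)"
    by (rule nn_integral_complex) measurable
  also have "\<dots> = (\<integral>\<^sup>+x. H (X x) * ennreal ((1 - c\<^sup>2) / (1 - c * x)\<^sup>2) * indicator {-1..1} x \<partial>lborel)"
    by (simp add: inner)
  also have "\<dots> = (\<integral>\<^sup>+x. H x * indicator {X (-1)..X 1} x \<partial>lborel)"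
  proof (rule nn_integral_substitution_aux[symmetric])
    fix x :: real assume x: "x \<in> {-1..1}"
    have "(X has_real_derivative (1 * (1 - c * x) - (x - c) * (- c)) / ((1 - c * x) * (1 - c * x))) (at x)"
      unfolding X_def using pos[OF x] by (auto intro!: derivative_eq_intros)
    also have "(1 * (1 - c * x) - (x - c) * (- c)) / ((1 - c * x) * (1 - c * x)) = (1 - c\<^sup>2) / (1 - c * x)\<^sup>2"
      by (simp add: power2_eq_square algebra_simps)
    finally show "(X has_real_derivative (1 - c\<^sup>2) / (1 - c * x)\<^sup>2) (at x)" .
    show "0 \<le> (1 - c\<^sup>2) / (1 - c * x)\<^sup>2" using c2 by simp
  next
    show "continuous_on {- 1..1} (\<lambda>x. (1 - c\<^sup>2) / (1 - c * x)\<^sup>2)"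
      using pos by (intro continuous_intros) force
  qed auto
  also have "\<dots> = (\<integral>\<^sup>+x. H x \<partial>lborel)"
    unfolding X1 H_def G_def
    by (intro nn_integral_cong) (auto simp: outside indicator_def)
  also have "\<dots> = (\<integral>\<^sup>+z. G z \<partial>lborel)" unfolding H_def by (subst nn_integral_complex(1)) auto
  finally show ?thesis by (simp add: nn_integral_hyp_measure G_def)
qed

section \<open>Area of isosceles triangles and of polygons containing their center\<close>

text \<open>An antiderivative of the density along a vertical line. Taken between
  \<open>- k * x\<close> and \<open>k * x\<close>, it leaves the integrand of the next
  lemma.\<close>

lemma has_derivative_vertical:
  fixes x y :: real
  assumes "x\<^sup>2 + y\<^sup>2 < 1"
  shows "((\<lambda>y. y / ((1 - x\<^sup>2) * sqrt (1 - x\<^sup>2 - y\<^sup>2))) has_real_derivative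
     1 / sqrt (1 - x\<^sup>2 - y\<^sup>2) ^ 3) (at y)"
proof -
  define m where "m = sqrt (1 - x\<^sup>2 - y\<^sup>2)"
  have m: "0 < m" "m * m = 1 - x\<^sup>2 - y\<^sup>2" using assms by (auto simp: m_def)
  have x: "0 < 1 - x\<^sup>2" using assms zero_le_power2[of y] by linarith
  have "((\<lambda>y. y / ((1 - x\<^sup>2) * sqrt (1 - x\<^sup>2 - y\<^sup>2))) has_real_derivative
     ((1 - x\<^sup>2) * m - y * ((1 - x\<^sup>2) * (- (2 * y) * (inverse m / 2)))) / (((1 - x\<^sup>2) * m) * ((1 - x\<^sup>2) * m))) (at y)"
    using assms m x unfolding m_def by (auto intro!: derivative_eq_intros)
  also have "((1 - x\<^sup>2) * m - y * ((1 - x\<^sup>2) * (- (2 * y) * (inverse m / 2)))) / (((1 - x\<^sup>2) * m) * ((1 - x\<^sup>2) * m))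
      = (m * m + y * y) / ((1 - x\<^sup>2) * m ^ 3)"
    using m(1) x by (simp add: divide_simps) (simp add: power2_eq_square power3_eq_cube algebra_simps)
  also have "m * m + y * y = 1 - x\<^sup>2" unfolding m by (simp add: power2_eq_square)
  finally show ?thesis using x by (simp add: m_def)
qed

lemma has_derivative_horizontal:
  fixes x k :: real
  assumes "(1 + k\<^sup>2) * x\<^sup>2 < 1" "0 < k"
  shows "((\<lambda>x. - 2 * arctan (sqrt (1 - (1 + k\<^sup>2) * x\<^sup>2) / k)) has_real_derivative
     2 * k * x / ((1 - x\<^sup>2) * sqrt (1 - (1 + k\<^sup>2) * x\<^sup>2))) (at x)"
proof -
  define m where "m = sqrt (1 - (1 + k\<^sup>2) * x\<^sup>2)"
  have m: "0 < m" "m * m = 1 - (1 + k\<^sup>2) * x\<^sup>2" using assms by (auto simp: m_def)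
  have "1 * x\<^sup>2 \<le> (1 + k\<^sup>2) * x\<^sup>2" by (intro mult_right_mono) auto
  then have x: "0 < 1 - x\<^sup>2" using assms by linarith
  have k: "0 < 1 + k\<^sup>2" by (simp add: add_pos_nonneg)
  have "((\<lambda>x. - 2 * arctan (sqrt (1 - (1 + k\<^sup>2) * x\<^sup>2) / k)) has_real_derivative
     - 2 * (inverse (1 + (m / k)\<^sup>2) * (- ((1 + k\<^sup>2) * (2 * x)) * (inverse m / 2) / k))) (at x)"
    using assms m unfolding m_def by (auto intro!: derivative_eq_intros)
  also have "inverse (1 + (m / k)\<^sup>2) = k\<^sup>2 / ((1 + k\<^sup>2) * (1 - x\<^sup>2))"
  proof -
    have "1 + (m / k)\<^sup>2 = (k\<^sup>2 + m * m) / k\<^sup>2"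
      using assms by (simp add: power_divide power2_eq_square field_simps)
    also have "k\<^sup>2 + m * m = (1 + k\<^sup>2) * (1 - x\<^sup>2)" unfolding m by (simp add: algebra_simps)
    finally show ?thesis by simp
  qed
  also have "- 2 * (k\<^sup>2 / ((1 + k\<^sup>2) * (1 - x\<^sup>2)) * (- ((1 + k\<^sup>2) * (2 * x)) * (inverse m / 2) / k))
     = 2 * k * x / ((1 - x\<^sup>2) * m)"
    using assms m(1) x k by (simp add: divide_simps) (simp add: power2_eq_square)
  finally show ?thesis by (simp add: m_def)
qed

text \<open>The value is the angle defect: the apex angle is \<open>2 * arctan k\<close>, and the
  second arctangent is the angle at the base. One of the two legs and the apex are left out so that
  neighbouring triangles of a polygon do not overlap.\<close>

lemma emeasure_hyp_measure_triangle:
  assumes k: "0 < k" and h: "0 < h" "(1 + k\<^sup>2) * h\<^sup>2 < 1"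
  shows "emeasure hyp_measure {z. 0 < Re z \<and> Re z \<le> h \<and> - k * Re z \<le> Im z \<and> Im z < k * Re z}
    = ennreal (2 * (arctan (1 / k) - arctan (sqrt (1 - (1 + k\<^sup>2) * h\<^sup>2) / k)))"
proof -
  define T where "T = {z. 0 < Re z \<and> Re z \<le> h \<and> - k * Re z \<le> Im z \<and> Im z < k * Re z}"
  have [measurable]: "T \<in> sets borel" unfolding T_def by measurable
  have small: "(1 + k\<^sup>2) * x\<^sup>2 < 1" if "0 \<le> x" "x \<le> h" for x
  proof -
    have "x\<^sup>2 \<le> h\<^sup>2" using that by (intro power_mono) auto
    then have "(1 + k\<^sup>2) * x\<^sup>2 \<le> (1 + k\<^sup>2) * h\<^sup>2" by (intro mult_left_mono) auto
    then show ?thesis using h by linarith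
  qed
  define F where "F = (\<lambda>x y. y / ((1 - x\<^sup>2) * sqrt (1 - x\<^sup>2 - y\<^sup>2)))"
  have inner: "(\<integral>\<^sup>+y. hyp_density (Complex x y) * indicator T (Complex x y) \<partial>lborel)
      = ennreal (2 * k * x / ((1 - x\<^sup>2) * sqrt (1 - (1 + k\<^sup>2) * x\<^sup>2))) * indicator {0..h} x"
    if "x \<noteq> 0" for x
  proof (cases "x \<in> {0..h}")
    case True
    then have x: "0 < x" "x \<le> h" using that by auto
    have ball: "x\<^sup>2 + y\<^sup>2 < 1" if "y \<in> {- k * x..k * x}" for y
    proof -
      have "\<bar>y\<bar> \<le> \<bar>k * x\<bar>" using that by auto
      then have "y\<^sup>2 \<le> (k * x)\<^sup>2" by (simp add: abs_le_square_iff)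
      then show ?thesis using small[of x] x by (simp add: power_mult_distrib algebra_simps)
    qed
    have "(\<integral>\<^sup>+y. hyp_density (Complex x y) * indicator T (Complex x y) \<partial>lborel)
        = (\<integral>\<^sup>+y. ennreal (1 / sqrt (1 - x\<^sup>2 - y\<^sup>2) ^ 3) * indicator {- k * x..k * x} y \<partial>lborel)"
    proof (rule nn_integral_cong_AE, rule AE_mp[OF AE_lborel_singleton[of "k * x"]], rule AE_I2, rule impI)
      fix y assume "y \<noteq> k * x"
      then show "hyp_density (Complex x y) * indicator T (Complex x y)
          = ennreal (1 / sqrt (1 - x\<^sup>2 - y\<^sup>2) ^ 3) * indicator {- k * x..k * x} y"
        using x ball[of y]
        by (auto simp: hyp_density_def hyp_plane_iff cmod_power2 T_def indicator_def diff_diff_eq)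
    qed
    also have "\<dots> = ennreal (F x (k * x) - F x (- k * x))"
      unfolding F_def using ball x k
      by (intro nn_integral_FTC_Icc has_derivative_vertical) (auto simp: diff_diff_eq less_imp_le)
    also have "F x (k * x) - F x (- k * x) = 2 * k * x / ((1 - x\<^sup>2) * sqrt (1 - (1 + k\<^sup>2) * x\<^sup>2))"
      by (simp add: F_def power_mult_distrib algebra_simps)
    finally show ?thesis using True by simp
  qed (use that in \<open>auto simp: T_def indicator_def\<close>)
  have "emeasure hyp_measure T = (\<integral>\<^sup>+z. hyp_density z * indicator T z \<partial>lborel)"
    by (simp add: hyp_measure_def emeasure_density)
  also have "\<dots> = (\<integral>\<^sup>+x. \<integral>\<^sup>+y. hyp_density (Complex x y) * indicator T (Complex x y) \<partial>lborel \<partial>lborel)"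
    by (rule nn_integral_complex) measurable
  also have "\<dots> = (\<integral>\<^sup>+x. ennreal (2 * k * x / ((1 - x\<^sup>2) * sqrt (1 - (1 + k\<^sup>2) * x\<^sup>2))) * indicator {0..h} x \<partial>lborel)"
    by (rule nn_integral_cong_AE, rule AE_mp[OF AE_lborel_singleton[of 0]], rule AE_I2) (simp add: inner)
  also have "\<dots> = ennreal (- 2 * arctan (sqrt (1 - (1 + k\<^sup>2) * h\<^sup>2) / k) - - 2 * arctan (sqrt (1 - (1 + k\<^sup>2) * 0\<^sup>2) / k))"
  proof (rule nn_integral_FTC_Icc)
    fix x assume x: "x \<in> {0..h}"
    then have s: "(1 + k\<^sup>2) * x\<^sup>2 < 1" using small by auto
    have "1 * x\<^sup>2 \<le> (1 + k\<^sup>2) * x\<^sup>2" by (intro mult_right_mono) auto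
    then have "0 < 1 - x\<^sup>2" using s by linarith
    then show "0 \<le> 2 * k * x / ((1 - x\<^sup>2) * sqrt (1 - (1 + k\<^sup>2) * x\<^sup>2))"
      using x k s by auto
    show "((\<lambda>x. - 2 * arctan (sqrt (1 - (1 + k\<^sup>2) * x\<^sup>2) / k)) has_real_derivative
       2 * k * x / ((1 - x\<^sup>2) * sqrt (1 - (1 + k\<^sup>2) * x\<^sup>2))) (at x)"
      by (rule has_derivative_horizontal[OF s k])
  qed (use h in auto)
  finally show ?thesis by (simp add: T_def)
qed

text \<open>Consider the right triangle with hypotenuse \<open>r\<close>, angle \<open>a\<close> and
  opposite leg \<open>\<delta>\<close>. Both sides are the complement of its third angle, whose
  cotangent is \<open>cosh r * tan a\<close> and whose cosine is
  \<open>tanh \<delta> / tanh r\<close>.\<close>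

lemma arctan_eq_arcsin_tanh:
  assumes "0 < a" "a < pi / 2" "0 < r" "sinh \<delta> = sinh r * sin a"
  shows "arctan (cosh r * tan a) = arcsin (tanh \<delta> / tanh r)"
proof -
  have c: "0 < cos a" using assms by (intro cos_gt_zero) auto
  have "1 + (cosh r * tan a)\<^sup>2 = ((cos a)\<^sup>2 + (cosh r)\<^sup>2 * (sin a)\<^sup>2) / (cos a)\<^sup>2"
    using c by (simp add: tan_def field_simps)
  also have "(cos a)\<^sup>2 + (cosh r)\<^sup>2 * (sin a)\<^sup>2 = (cosh \<delta>)\<^sup>2"
    unfolding cosh_square_eq assms(4) by (simp add: cos_squared_eq algebra_simps)
  finally have s: "sqrt (1 + (cosh r * tan a)\<^sup>2) = cosh \<delta> / cos a"
    using c by (simp add: real_sqrt_divide)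
  have "sin (arctan (cosh r * tan a)) = tanh \<delta> / tanh r"
    unfolding sin_arctan s using c assms by (simp add: tanh_def tan_def)
  moreover have "arcsin (sin (arctan (cosh r * tan a))) = arctan (cosh r * tan a)"
    using arctan_bounded[of "cosh r * tan a"] by (intro arcsin_sin) auto
  ultimately show ?thesis by simp
qed

text \<open>The base is the vertical chord between the angles \<open>- a\<close> and
  \<open>a\<close> on the circle of Euclidean radius \<open>tanh r\<close>, and
  \<open>\<delta>\<close> is half its hyperbolic length.\<close>

lemma emeasure_hyp_measure_isosceles:
  assumes a: "0 < a" "a < pi / 2" and r: "0 < r" and \<delta>: "sinh \<delta> = sinh r * sin a"
  shows "emeasure hyp_measure {z. 0 < Re z \<and> Re z \<le> tanh r * cos a \<and>
            - tan a * Re z \<le> Im z \<and> Im z < tan a * Re z}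
    = ennreal (2 * (arcsin (tanh \<delta> / tanh r) - a))"
proof -
  have c: "0 < cos a" "0 < tan a" using a by (auto intro: cos_gt_zero tan_gt_zero)
  have "(1 + (tan a)\<^sup>2) * (cos a)\<^sup>2 = (cos a)\<^sup>2 + (sin a)\<^sup>2"
    using c(1) by (simp add: tan_def power_divide distrib_right)
  then have t: "(1 + (tan a)\<^sup>2) * (tanh r * cos a)\<^sup>2 = (tanh r)\<^sup>2"
    using c(1) unfolding power_mult_distrib by simp
  have w: "sqrt (1 - (1 + (tan a)\<^sup>2) * (tanh r * cos a)\<^sup>2) = 1 / cosh r"
    unfolding t one_minus_tanh_square by (simp add: real_sqrt_divide)
  have "arctan (tan a) = a" using a by (intro arctan_tan) auto
  then have e1: "arctan (1 / tan a) = pi / 2 - a"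
    using arctan_inverse[of "tan a"] c by (simp add: inverse_eq_divide)
  have e2: "arctan (1 / cosh r / tan a) = pi / 2 - arcsin (tanh \<delta> / tanh r)"
    using arctan_inverse[of "cosh r * tan a"] c arctan_eq_arcsin_tanh[OF a r \<delta>]
    by (simp add: sgn_mult inverse_eq_divide)
  have "(tanh r)\<^sup>2 < 1"
    using tanh_real_lt_1[of r] r by (simp add: abs_square_less_1)
  then have "emeasure hyp_measure {z. 0 < Re z \<and> Re z \<le> tanh r * cos a \<and>
            - tan a * Re z \<le> Im z \<and> Im z < tan a * Re z}
    = ennreal (2 * ((pi / 2 - a) - (pi / 2 - arcsin (tanh \<delta> / tanh r))))"
    using emeasure_hyp_measure_triangle[of "tan a" "tanh r * cos a", unfolded w e1 e2] c r
    unfolding t by (simp only: mult_pos_pos tanh_real_pos_iff)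
  then show ?thesis by (simp add: algebra_simps)
qed

section \<open>Polygons around the origin, cut into sectors\<close>

lemma norm_mult_cis_Arg2pi: "complex_of_real (norm z) * cis (Arg2pi z) = z"
  using Arg2pi_eq[of z] by (simp add: cis_conv_exp)

lemma Arg2pi_mult_cis:
  assumes "0 < s" "0 \<le> t" "t < 2 * pi"
  shows "Arg2pi (complex_of_real s * cis t) = t"
  using Arg2pi_unique[of s t] assms by (simp add: cis_conv_exp)

lemma Arg2pi_borel [measurable]: "Arg2pi \<in> borel_measurable borel"
  by (rule borel_measurableI_greater) (simp add: open_Arg2pi2pi_gt)

lemma Re_cis_mult: "Re (cis (- m) * (complex_of_real s * cis t)) = s * cos (t - m)"
  by (simp add: cos_diff algebra_simps)

lemma cos_le_cos_abs:
  fixes x a :: real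
  assumes "0 \<le> a" "a \<le> \<bar>x\<bar>" "\<bar>x\<bar> \<le> 2 * pi - a"
  shows "cos x \<le> cos a"
proof (cases "\<bar>x\<bar> \<le> pi")
  case True
  then have "cos \<bar>x\<bar> \<le> cos a" using assms by (intro cos_monotone_0_pi_le) auto
  then show ?thesis by simp
next
  case False
  then have "cos (2 * pi - \<bar>x\<bar>) \<le> cos a" using assms by (intro cos_monotone_0_pi_le) auto
  then show ?thesis by (simp add: cos_diff)
qed

text \<open>Disposes of the degenerate triangle over a side that is a diameter, and of the center
  itself.\<close>

lemma emeasure_hyp_measure_imaginary_axis: "emeasure hyp_measure {z. Re z = 0} = 0"
proof -
  define I :: "complex set" where "I = {z. Re z = 0}"
  have [measurable]: "I \<in> sets borel" unfolding I_def
    by (intro borel_closed closed_Collect_eq continuous_intros)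
  have "emeasure hyp_measure I = (\<integral>\<^sup>+z. hyp_density z * indicator I z \<partial>lborel)"
    by (simp add: hyp_measure_def emeasure_density)
  also have "\<dots> = (\<integral>\<^sup>+x. \<integral>\<^sup>+y. hyp_density (Complex x y) * indicator I (Complex x y) \<partial>lborel \<partial>lborel)"
    by (rule nn_integral_complex) measurable
  also have "\<dots> = (\<integral>\<^sup>+x. 0 \<partial>(lborel :: real measure))"
    by (rule nn_integral_cong_AE, rule AE_mp[OF AE_lborel_singleton[of 0]], rule AE_I2) (simp add: I_def)
  finally show ?thesis by (simp add: I_def)
qed

lemma emeasure_hyp_measure_rotate:
  assumes "norm u = 1" "S \<in> sets borel"
  shows "emeasure hyp_measure {z. u * z \<in> S} = emeasure hyp_measure S"
proof -
  have [measurable]: "S \<in> sets borel" by fact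
  have "{z. u * z \<in> S} = (\<lambda>z. u * z) -` S \<inter> space borel" by auto
  also have "\<dots> \<in> sets borel" by measurable
  finally have [measurable]: "{z. u * z \<in> S} \<in> sets borel" .
  have "emeasure hyp_measure {z. u * z \<in> S} = (\<integral>\<^sup>+z. indicator {z. u * z \<in> S} z \<partial>hyp_measure)" by simp
  also have "\<dots> = (\<integral>\<^sup>+z. indicator S (u * z) \<partial>hyp_measure)"
    by (intro nn_integral_cong) (simp add: indicator_def)
  also have "\<dots> = (\<integral>\<^sup>+z. indicator S z \<partial>hyp_measure)"
    by (rule nn_integral_hyp_measure_rotate[OF assms(1)]) simp
  finally show ?thesis by simp
qed

text \<open>The vertices have arguments \<open>b i\<close> for \<open>i < n\<close>; the extra value
  \<open>b n = 2 * pi\<close> closes the polygon, so that side \<open>i\<close> always runs from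
  \<open>b i\<close> to \<open>b (Suc i)\<close>. Gaps of at most \<open>pi\<close> keep the center
  in the polygon, and a gap of exactly \<open>pi\<close> is a side through the center.\<close>

locale centered_polygon =
  fixes n :: nat and b :: "nat \<Rightarrow> real" and \<rho> :: real
  assumes \<rho>: "0 < \<rho>"
    and b_0: "b 0 = 0" and b_n: "b n = 2 * pi"
    and gap: "\<And>i. i < n \<Longrightarrow> b i < b (Suc i) \<and> b (Suc i) \<le> b i + pi"
begin

definition polygon :: "complex set" where
  "polygon = convex hull ((\<lambda>i. complex_of_real \<rho> * cis (b i)) ` {..<n})"

definition half :: "nat \<Rightarrow> real" where "half i = (b (Suc i) - b i) / 2"

definition mid :: "nat \<Rightarrow> real" where "mid i = (b (Suc i) + b i) / 2"

lemma n_pos: "0 < n"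
  using b_0 b_n by (cases n) auto

lemma b_mono: "j \<le> n \<Longrightarrow> i \<le> j \<Longrightarrow> b i \<le> b j"
proof (induction j)
  case (Suc j)
  then show ?case using gap[of j] by (cases "i = Suc j") auto
qed simp

lemma b_range: "i \<le> n \<Longrightarrow> 0 \<le> b i \<and> b i \<le> 2 * pi"
  using b_mono[of i 0] b_mono[of n i] b_0 b_n by auto

lemma half_range: "i < n \<Longrightarrow> 0 < half i \<and> half i \<le> pi / 2"
  using gap[of i] by (simp add: half_def)

lemma mid_half: "mid i - half i = b i" "mid i + half i = b (Suc i)"
  by (simp_all add: mid_def half_def field_simps)

lemma vertex_in_polygon: "i \<le> n \<Longrightarrow> complex_of_real \<rho> * cis (b i) \<in> polygon"
proof (cases "i = n")
  case True
  have "complex_of_real \<rho> * cis (b 0) \<in> polygon"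
    unfolding polygon_def using n_pos by (intro hull_inc) auto
  then show ?thesis using True b_0 b_n by (simp add: cis_2pi)
next
  case False
  moreover assume "i \<le> n"
  ultimately show ?thesis unfolding polygon_def by (intro hull_inc imageI) auto
qed

lemma compact_polygon: "compact polygon"
  unfolding polygon_def by (intro compact_convex_hull finite_imp_compact) auto

text \<open>Rotation by \<open>- mid i\<close> makes side \<open>i\<close> the vertical chord with
  real part \<open>\<rho> * cos (half i)\<close>. On the circle, every vertex is at least
  \<open>half i\<close> away from the direction \<open>mid i\<close>, hence not beyond that
  chord.\<close>

lemma polygon_halfplane:
  assumes "i < n" "z \<in> polygon"
  shows "Re (cis (- mid i) * z) \<le> \<rho> * cos (half i)"
proof -
  have "convex {z. Re (cis (- mid i) * z) \<le> \<rho> * cos (half i)}"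
  proof -
    have "{z. Re (cis (- mid i) * z) \<le> \<rho> * cos (half i)} = {z. inner (cis (mid i)) z \<le> \<rho> * cos (half i)}"
      by (simp add: inner_complex_def)
    then show ?thesis by (simp add: convex_halfspace_le)
  qed
  moreover have "(\<lambda>i. complex_of_real \<rho> * cis (b i)) ` {..<n} \<subseteq> {z. Re (cis (- mid i) * z) \<le> \<rho> * cos (half i)}"
  proof (rule image_subsetI)
    fix j assume j: "j \<in> {..<n}"
    have "b j \<le> b i \<or> b (Suc i) \<le> b j"
      using assms j b_mono[of i j] b_mono[of j "Suc i"] by (cases "j \<le> i") auto
    then have "cos (b j - mid i) \<le> cos (half i)"
      using half_range[OF assms(1)] b_range[of j] b_range[of i] b_range[of "Suc i"] j assms mid_half[of i]
      by (intro cos_le_cos_abs) (auto simp: abs_if)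
    then show "complex_of_real \<rho> * cis (b j) \<in> {z. Re (cis (- mid i) * z) \<le> \<rho> * cos (half i)}"
      using \<rho> by (simp only: mem_Collect_eq Re_cis_mult) simp
  qed
  ultimately have "polygon \<subseteq> {z. Re (cis (- mid i) * z) \<le> \<rho> * cos (half i)}"
    unfolding polygon_def by (intro hull_minimal)
  then show ?thesis using assms by auto
qed

lemma sector_exists:
  assumes "0 \<le> \<phi>" "\<phi> < 2 * pi"
  shows "\<exists>i<n. b i \<le> \<phi> \<and> \<phi> < b (Suc i)"
proof -
  have "\<phi> < b m \<Longrightarrow> \<exists>i<m. b i \<le> \<phi> \<and> \<phi> < b (Suc i)" for m
  proof (induction m)
    case (Suc m)
    then show ?case by (cases "\<phi> < b m") (auto intro: less_SucI)
  qed (use assms b_0 in auto)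
  then show ?thesis using assms b_n by simp
qed

text \<open>If \<open>0\<close> were outside the polygon, all the vertices would lie in an open half plane, hence some
  gap would exceed \<open>pi\<close>.\<close>

lemma zero_in_polygon: "0 \<in> polygon"
proof (rule ccontr)
  assume "0 \<notin> polygon"
  then obtain u \<beta> where u: "inner u 0 < \<beta>" "\<And>x. x \<in> polygon \<Longrightarrow> \<beta> < inner u x"
    using separating_hyperplane_closed_point[of polygon 0] compact_polygon
    by (auto simp: polygon_def compact_imp_closed)
  then have pos: "0 < inner u x" if "x \<in> polygon" for x using that by (simp add: less_trans)
  define \<phi> where "\<phi> = Arg2pi (- u)"
  have u_eq: "u = - (complex_of_real (norm u) * cis \<phi>)"
    using norm_mult_cis_Arg2pi[of "- u"] by (simp add: \<phi>_def)
  obtain i where i: "i < n" "b i \<le> \<phi>" "\<phi> < b (Suc i)"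
    using sector_exists[of \<phi>] Arg2pi_ge_0 Arg2pi_lt_2pi by (auto simp: \<phi>_def)
  have inner_eq: "inner u (complex_of_real \<rho> * cis t) = - (norm u * \<rho> * cos (\<phi> - t))" for t
    by (subst u_eq) (simp add: inner_complex_def cos_diff algebra_simps)
  \<comment> \<open>The direction of \<open>- u\<close> lies in a gap of at most \<open>pi\<close>,
    so one end of that gap is within \<open>pi / 2\<close> of it; the vertex there violates the
    separation.\<close>
  obtain j where j: "j \<le> n" "\<bar>\<phi> - b j\<bar> \<le> pi / 2"
  proof (cases "\<phi> - b i \<le> pi / 2")
    case True
    then show ?thesis using that[of i] i by auto
  next
    case False
    then show ?thesis using that[of "Suc i"] i gap[OF i(1)] by auto
  qed
  have "0 \<le> cos (\<phi> - b j)" using j by (intro cos_ge_zero) linarith+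
  then have "inner u (complex_of_real \<rho> * cis (b j)) \<le> 0" using \<rho> by (simp add: inner_eq)
  then show False using pos[OF vertex_in_polygon[OF j(1)]] by simp
qed

text \<open>The converse of \<open>polygon_halfplane\<close> inside one sector: the point lies in
  the triangle spanned by 0 and the two vertices of side \<open>i\<close>.\<close>

lemma sector_in_polygon:
  assumes i: "i < n" "half i < pi / 2" and t: "\<bar>t\<bar> \<le> half i"
    and s: "0 \<le> s" "s * cos t \<le> \<rho> * cos (half i)"
  shows "complex_of_real s * cis (mid i + t) \<in> polygon"
proof -
  define a where "a = half i"
  have a: "0 < a" "a < pi / 2" using half_range[OF i(1)] i by (auto simp: a_def)
  have sc: "0 < sin a" "0 < cos a" using a by (auto intro!: sin_gt_zero cos_gt_zero)
  have s2: "0 < sin (2 * a)" using a by (intro sin_gt_zero) auto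
  \<comment> \<open>Barycentric coordinates for the two vertices, from Cramer's rule. The
    determinant \<open>sin (2 * a)\<close> would vanish for a gap of \<open>pi\<close>.\<close>
  define v where "v = s * sin (a - t) / (\<rho> * sin (2 * a))"
  define w where "w = s * sin (a + t) / (\<rho> * sin (2 * a))"
  have "0 \<le> sin (a - t)" "0 \<le> sin (a + t)"
    using t a by (auto simp: a_def[symmetric] intro!: sin_ge_zero)
  then have vw0: "0 \<le> v" "0 \<le> w" using s s2 \<rho> by (auto simp: v_def w_def)
  have "v + w = s * cos t / (\<rho> * cos a)"
  proof -
    have "v + w = s * (sin (a - t) + sin (a + t)) / (\<rho> * sin (2 * a))"
      by (simp add: v_def w_def distrib_left add_divide_distrib)
    also have "sin (a - t) + sin (a + t) = 2 * sin a * cos t" by (simp add: sin_add sin_diff)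
    finally show ?thesis using sc by (simp add: sin_double)
  qed
  also have "\<dots> \<le> 1" using s sc \<rho> by (simp add: a_def)
  finally have vw1: "v + w \<le> 1" .
  have c: "sin (2 * a) * cis t = sin (a - t) * cis (- a) + sin (a + t) * cis a"
  proof -
    have "sin (2 * a) * cos t = (sin (a - t) + sin (a + t)) * cos a"
      by (simp add: sin_add sin_diff sin_double)
    moreover have "sin (2 * a) * sin t = (sin (a + t) - sin (a - t)) * sin a"
      by (simp add: sin_add sin_diff sin_double)
    ultimately show ?thesis by (simp add: complex_eq_iff algebra_simps)
  qed
  have v\<rho>: "complex_of_real (v * \<rho> * sin (2 * a)) = complex_of_real (s * sin (a - t))"
    "complex_of_real (w * \<rho> * sin (2 * a)) = complex_of_real (s * sin (a + t))"
    using s2 \<rho> by (simp_all add: v_def w_def)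
  have "complex_of_real (sin (2 * a)) * (complex_of_real s * cis (mid i + t))
      = s * cis (mid i) * (sin (2 * a) * cis t)"
    by (simp add: cis_mult[symmetric] ac_simps)
  also have "\<dots> = cis (mid i) * (complex_of_real (s * sin (a - t)) * cis (- a) + complex_of_real (s * sin (a + t)) * cis a)"
    unfolding c by (simp add: algebra_simps)
  also have "\<dots> = sin (2 * a) * (v * (\<rho> * cis (mid i - a)) + w * (\<rho> * cis (mid i + a)))"
  proof -
    have "cis (mid i - a) = cis (mid i) * cis (- a)" "cis (mid i + a) = cis (mid i) * cis a"
      by (simp_all add: cis_mult)
    then show ?thesis unfolding v\<rho>[symmetric] by (simp add: algebra_simps)
  qed
  finally have point: "complex_of_real s * cis (mid i + t)
      = (1 - v - w) *\<^sub>R 0 + v *\<^sub>R (\<rho> * cis (b i)) + w *\<^sub>R (\<rho> * cis (b (Suc i)))"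
    using s2 by (simp add: scaleR_conv_of_real a_def mid_half)
  have "complex_of_real s * cis (mid i + t) \<in> convex hull {0, \<rho> * cis (b i), \<rho> * cis (b (Suc i))}"
    unfolding convex_hull_3 mem_Collect_eq
  proof (intro exI conjI)
    show "0 \<le> 1 - v - w" "1 - v - w + v + w = 1" using vw1 by auto
  qed (fact point vw0)+
  also have "\<dots> \<subseteq> polygon"
    using i zero_in_polygon vertex_in_polygon[of i] vertex_in_polygon[of "Suc i"]
    by (intro hull_minimal) (auto simp: polygon_def)
  finally show ?thesis .
qed

text \<open>Half-open, so that the sectors partition the plane without 0, where
  \<open>Arg2pi\<close> has only a default value.\<close>

definition sector :: "nat \<Rightarrow> complex set" where
  "sector i = {z. z \<noteq> 0 \<and> b i \<le> Arg2pi z \<and> Arg2pi z < b (Suc i)}"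

lemma sector_borel [measurable]: "sector i \<in> sets borel"
  unfolding sector_def by measurable

lemma polygon_borel [measurable]: "polygon \<in> sets borel"
  using compact_polygon by (simp add: compact_imp_closed borel_closed)

text \<open>The second part gives exactly the triangle of
  \<open>emeasure_hyp_measure_isosceles\<close>. The first part is for a gap of \<open>pi\<close>,
  where it confines the set to the imaginary axis.\<close>

lemma rotated_sector:
  assumes i: "i < n"
  shows "{w. cis (mid i) * w \<in> polygon \<inter> sector i} \<subseteq> {w. 0 \<le> Re w \<and> Re w \<le> \<rho> * cos (half i)}"
    and "half i < pi / 2 \<Longrightarrow> {w. cis (mid i) * w \<in> polygon \<inter> sector i} =
      {w. 0 < Re w \<and> Re w \<le> \<rho> * cos (half i) \<and> - tan (half i) * Re w \<le> Im w \<and> Im w < tan (half i) * Re w}"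
proof -
  define a where "a = half i"
  have a: "0 < a" "a \<le> pi / 2" using half_range[OF i(1)] by (auto simp: a_def)
  have polar: "\<exists>t. - a \<le> t \<and> t < a \<and> w = complex_of_real (norm w) * cis t \<and> 0 < norm w \<and> Re w \<le> \<rho> * cos a"
    if w: "cis (mid i) * w \<in> polygon \<inter> sector i" for w
  proof -
    define z where "z = cis (mid i) * w"
    have zw: "cis (- mid i) * z = w" by (simp add: z_def cis_mult flip: mult.assoc)
    define t where "t = Arg2pi z - mid i"
    have "z = complex_of_real (norm w) * cis (mid i + t)"
      using norm_mult_cis_Arg2pi[of z] by (simp add: t_def z_def norm_mult)
    then have "cis (- mid i) * z = complex_of_real (norm w) * (cis (- mid i) * cis (mid i + t))"
      by (metis mult.left_commute)
    then have "w = complex_of_real (norm w) * (cis (- mid i) * cis (mid i + t))"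
      unfolding zw .
    then have "w = complex_of_real (norm w) * cis t" by (simp add: cis_mult)
    moreover have "- a \<le> t" "t < a"
      using w mid_half[of i] by (auto simp: sector_def z_def[symmetric] t_def a_def)
    moreover have "w \<noteq> 0" using w by (auto simp: sector_def)
    moreover have "Re w \<le> \<rho> * cos a"
      using polygon_halfplane[OF i, of z] w unfolding zw a_def[symmetric] by (simp add: z_def)
    ultimately show ?thesis by (intro exI[of _ t]) auto
  qed
  show "{w. cis (mid i) * w \<in> polygon \<inter> sector i} \<subseteq> {w. 0 \<le> Re w \<and> Re w \<le> \<rho> * cos (half i)}"
  proof clarify
    fix w assume "cis (mid i) * w \<in> polygon" "cis (mid i) * w \<in> sector i"
    then obtain t where t: "- a \<le> t" "t < a" "w = complex_of_real (norm w) * cis t" "Re w \<le> \<rho> * cos a"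
      using polar[of w] by auto
    have "0 \<le> cos t" using t a by (intro cos_ge_zero) auto
    then have "0 \<le> Re w" by (subst t(3)) simp
    then show "0 \<le> Re w \<and> Re w \<le> \<rho> * cos (half i)" using t by (simp add: a_def)
  qed
  assume "half i < pi / 2"
  then have a': "a < pi / 2" by (simp add: a_def)
  show "{w. cis (mid i) * w \<in> polygon \<inter> sector i} =
      {w. 0 < Re w \<and> Re w \<le> \<rho> * cos (half i) \<and> - tan (half i) * Re w \<le> Im w \<and> Im w < tan (half i) * Re w}"
  proof (intro set_eqI iffI; unfold mem_Collect_eq a_def[symmetric])
    fix w assume w: "cis (mid i) * w \<in> polygon \<inter> sector i"
    obtain t where t: "- a \<le> t" "t < a" "w = complex_of_real (norm w) * cis t" "0 < norm w" "Re w \<le> \<rho> * cos a"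
      using polar[OF w] by auto
    have ct: "0 < cos t" using t a' by (intro cos_gt_zero_pi) auto
    have Re: "Re w = norm w * cos t" and Im: "Im w = norm w * sin t"
      by (subst t(3), simp)+
    have "tan t < tan a" using t a a' by (intro tan_monotone) auto
    moreover have "tan (- a) \<le> tan t" using t a' by (intro tan_mono_le) auto
    moreover have "Im w = tan t * Re w" unfolding Re Im using ct by (simp add: tan_def)
    moreover have "0 < Re w" unfolding Re using t(4) ct by simp
    ultimately show "0 < Re w \<and> Re w \<le> \<rho> * cos a \<and> - tan a * Re w \<le> Im w \<and> Im w < tan a * Re w"
      using t(5) mult_right_mono[of "tan (- a)" "tan t" "Re w"] by simp
  next
    fix w assume w: "0 < Re w \<and> Re w \<le> \<rho> * cos a \<and> - tan a * Re w \<le> Im w \<and> Im w < tan a * Re w"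
    define t where "t = arctan (Im w / Re w)"
    have ct: "0 < cos t" by (simp add: t_def cos_arctan add_pos_nonneg)
    have tan_t: "tan t = Im w / Re w" by (simp add: t_def tan_arctan)
    have "- tan a \<le> Im w / Re w" "Im w / Re w < tan a"
      using w by (auto simp: pos_le_divide_eq pos_divide_less_eq)
    then have "arctan (tan (- a)) \<le> t" "t < arctan (tan a)" by (auto simp: t_def arctan_le_iff arctan_less_iff)
    moreover have "arctan (tan a) = a" using a a' by (intro arctan_tan) auto
    moreover have "arctan (tan (- a)) = - a" using a a' by (intro arctan_tan) auto
    ultimately have t: "- a \<le> t" "t < a" by auto
    define s where "s = Re w / cos t"
    have s: "0 < s" using ct w by (simp add: s_def)
    have sw: "w = complex_of_real s * cis t"
    proof -
      have "Im w = Re w * tan t" using tan_t w by simp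
      then show ?thesis using ct by (simp add: complex_eq_iff s_def tan_def)
    qed
    have m: "cis (mid i) * w = complex_of_real s * cis (mid i + t)"
      by (subst sw) (simp add: cis_mult[symmetric] ac_simps)
    have "cis (mid i) * w \<in> polygon"
      unfolding m using w s ct t a' i by (intro sector_in_polygon) (auto simp: a_def[symmetric] s_def abs_le_iff)
    moreover have "Arg2pi (cis (mid i) * w) = mid i + t"
      unfolding m using s t mid_half[of i] b_range[of i] b_range[of "Suc i"] i
      by (intro Arg2pi_mult_cis) (auto simp: a_def)
    moreover have "w \<noteq> 0" using w by auto
    ultimately show "cis (mid i) * w \<in> polygon \<inter> sector i"
      using t mid_half[of i] by (auto simp: sector_def a_def)
  qed
qed

lemma emeasure_sector:
  assumes i: "i < n" and r: "0 < r" "\<rho> = tanh r" and \<delta>: "sinh \<delta> = sinh r * sin (half i)"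
  shows "emeasure hyp_measure (polygon \<inter> sector i) = ennreal (2 * (arcsin (tanh \<delta> / tanh r) - half i))"
proof -
  have "polygon \<inter> sector i \<in> sets borel" by measurable
  then have rot: "emeasure hyp_measure (polygon \<inter> sector i) = emeasure hyp_measure {w. cis (mid i) * w \<in> polygon \<inter> sector i}"
    by (subst emeasure_hyp_measure_rotate) auto
  show ?thesis
  proof (cases "half i < pi / 2")
    case True
    show ?thesis
      unfolding rot rotated_sector(2)[OF i True]
      unfolding r(2) using half_range[OF i] True r(1) \<delta> by (intro emeasure_hyp_measure_isosceles) auto
  next
    \<comment> \<open>The side is a diameter. Its triangle lies on a line, and the formula also
      gives zero, since \<open>arcsin 1 = pi / 2\<close>.\<close>
    case False
    then have h: "half i = pi / 2" using half_range[OF i] by simp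
    then have "\<delta> = r" using \<delta> by (simp del: eq_divide_eq_numeral1)
    have "{w. cis (mid i) * w \<in> polygon \<inter> sector i} \<subseteq> {z. Re z = 0}"
      using rotated_sector(1)[OF i] unfolding h by auto
    moreover have "{z. Re z = 0} \<in> sets hyp_measure"
      by (simp add: borel_closed closed_Collect_eq continuous_on_Re)
    ultimately have "emeasure hyp_measure {w. cis (mid i) * w \<in> polygon \<inter> sector i} \<le> emeasure hyp_measure {z. Re z = 0}"
      by (rule emeasure_mono)
    then show ?thesis unfolding rot using \<open>\<delta> = r\<close> r h
      by (simp add: emeasure_hyp_measure_imaginary_axis)
  qed
qed

lemma hyp_area_polygon:
  assumes r: "0 < r" "\<rho> = tanh r" and \<delta>: "\<And>i. i < n \<Longrightarrow> sinh (\<delta> i) = sinh r * sin (half i)"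
  shows "hyp_area polygon = 2 * (\<Sum>i<n. arcsin (tanh (\<delta> i) / tanh r)) - 2 * pi"
proof -
  \<comment> \<open>The triangle areas must be known to be nonnegative before their
    \<open>ennreal\<close> values can be added as reals. The reason is
    \<open>sinh \<delta> / sinh r <= tanh \<delta> / tanh r\<close> for
    \<open>0 < \<delta> <= r\<close>.\<close>
  have nonneg: "0 \<le> 2 * (arcsin (tanh (\<delta> i) / tanh r) - half i)" if "i < n" for i
  proof -
    have h: "0 < half i" "half i \<le> pi / 2" using half_range[OF that] by auto
    have s: "0 < sin (half i)" using h by (intro sin_gt_zero) auto
    have "sinh (\<delta> i) \<le> sinh r" "0 < sinh (\<delta> i)"
      using \<delta>[OF that] s r(1) mult_left_mono[of "sin (half i)" 1 "sinh r"] by auto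
    then have d: "0 < \<delta> i" "\<delta> i \<le> r" by auto
    have "sin (half i) = sinh (\<delta> i) / sinh r" using \<delta>[OF that] r(1) by simp
    moreover have "arcsin (sin (half i)) = half i" using h by (intro arcsin_sin) auto
    ultimately have "half i = arcsin (sinh (\<delta> i) / sinh r)" by simp
    also have "\<dots> \<le> arcsin (tanh (\<delta> i) / tanh r)"
    proof (rule arcsin_le_arcsin)
      have "cosh (\<delta> i) \<le> cosh r" using d by (simp add: cosh_real_nonneg_le_iff)
      then have "sinh (\<delta> i) * (cosh (\<delta> i) * sinh r) \<le> sinh (\<delta> i) * (cosh r * sinh r)"
        using d r(1) by (intro mult_left_mono mult_right_mono) auto
      then show "sinh (\<delta> i) / sinh r \<le> tanh (\<delta> i) / tanh r"
        using r(1) by (simp add: tanh_def divide_simps ac_simps)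
      have "0 \<le> sinh (\<delta> i) / sinh r" using d r(1) by simp
      then show "- 1 \<le> sinh (\<delta> i) / sinh r" by linarith
      show "tanh (\<delta> i) / tanh r \<le> 1" using d r(1) by simp
    qed
    finally show ?thesis by simp
  qed
  have "(\<Sum>i<n. b (Suc i) - b i) = 2 * pi"
    using sum_lessThan_telescope[of b n] b_0 b_n by simp
  moreover have "2 * half i = b (Suc i) - b i" for i by (simp add: half_def)
  ultimately have "(\<Sum>i<n. 2 * half i) = 2 * pi" by presburger
  then have total: "(\<Sum>i<n. 2 * (arcsin (tanh (\<delta> i) / tanh r) - half i))
      = 2 * (\<Sum>i<n. arcsin (tanh (\<delta> i) / tanh r)) - 2 * pi"
    by (simp add: sum_subtractf sum_distrib_left right_diff_distrib)
  have disj: "disjoint_family_on sector {..<n}"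
  proof -
    have "sector i \<inter> sector j = {}" if "i < j" "j < n" for i j
      using that b_mono[of j "Suc i"] by (auto simp: sector_def)
    then show ?thesis
      unfolding disjoint_family_on_def by (metis Int_commute lessThan_iff nat_neq_iff)
  qed
  have cover: "polygon - {0} \<subseteq> (\<Union>i<n. sector i)"
  proof
    fix z assume z: "z \<in> polygon - {0}"
    obtain i where "i < n" "b i \<le> Arg2pi z" "Arg2pi z < b (Suc i)"
      using sector_exists[of "Arg2pi z"] Arg2pi_ge_0 Arg2pi_lt_2pi by blast
    then show "z \<in> (\<Union>i<n. sector i)" using z by (auto simp: sector_def)
  qed
  have "emeasure hyp_measure {0} \<le> emeasure hyp_measure {z. Re z = 0}"
    by (rule emeasure_mono) auto
  then have "{0} \<in> null_sets hyp_measure"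
    by (intro null_setsI) (auto simp: emeasure_hyp_measure_imaginary_axis)
  then have "emeasure hyp_measure polygon = emeasure hyp_measure (polygon - {0})"
    by (intro emeasure_Diff_null_set[symmetric]) auto
  also have "\<dots> = (\<Sum>i<n. emeasure hyp_measure ((polygon - {0}) \<inter> sector i))"
    by (rule sum_emeasure_cover) (auto simp: disj cover)
  also have "\<dots> = (\<Sum>i<n. ennreal (2 * (arcsin (tanh (\<delta> i) / tanh r) - half i)))"
  proof (rule sum.cong)
    fix i assume "i \<in> {..<n}"
    moreover have "(polygon - {0}) \<inter> sector i = polygon \<inter> sector i" by (auto simp: sector_def)
    ultimately show "emeasure hyp_measure ((polygon - {0}) \<inter> sector i) = ennreal (2 * (arcsin (tanh (\<delta> i) / tanh r) - half i))"
      using emeasure_sector[of i r "\<delta> i"] r \<delta> by simp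
  qed simp
  also have "\<dots> = ennreal (\<Sum>i<n. 2 * (arcsin (tanh (\<delta> i) / tanh r) - half i))"
    using nonneg by (intro sum_ennreal) auto
  finally have em: "emeasure hyp_measure polygon = ennreal (2 * (\<Sum>i<n. arcsin (tanh (\<delta> i) / tanh r)) - 2 * pi)"
    unfolding total .
  have nn: "0 \<le> 2 * (\<Sum>i<n. arcsin (tanh (\<delta> i) / tanh r)) - 2 * pi"
    unfolding total[symmetric] using nonneg by (intro sum_nonneg) auto
  have "polygon \<subseteq> hyp_plane"
    unfolding polygon_def using \<rho> r tanh_real_lt_1[of r]
    by (intro hull_minimal) (auto simp: hyp_plane_def norm_mult)
  then have "hyp_area polygon = measure hyp_measure polygon" by (intro hyp_area_eq_measure) auto
  then show ?thesis using em nn by (simp add: measure_def)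
qed

end

section \<open>Motions and the cyclic order\<close>

lemma Arg2pi_less_pi_iff:
  "z \<noteq> 0 \<Longrightarrow> Arg2pi z < pi \<longleftrightarrow> 0 < Im z \<or> Im z = 0 \<and> 0 < Re z"
  using Arg2pi_lt_pi[of z] Arg2pi_eq_0[of z] Arg2pi_ge_0[of z]
  by (auto simp: complex_is_Real_iff complex_eq_iff)

lemma Arg2pi_pos_iff: "0 < Arg2pi z \<longleftrightarrow> \<not> (Im z = 0 \<and> 0 \<le> Re z)"
  using Arg2pi_eq_0[of z] Arg2pi_ge_0[of z] by (auto simp: complex_is_Real_iff)

text \<open>Angles are compared by the half turns they lie in and, within one half turn, by the sign
  of the sine of their difference, which is the sign of the determinant
  \<open>Im (cnj z * w)\<close>.\<close>

lemma Arg2pi_le_iff: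
  assumes z: "z \<noteq> 0" and w: "w \<noteq> 0"
  shows "Arg2pi z \<le> Arg2pi w \<longleftrightarrow>
    Arg2pi z < pi \<and> \<not> Arg2pi w < pi \<or>
    (Arg2pi z < pi \<longleftrightarrow> Arg2pi w < pi) \<and> 0 \<le> Im (cnj z * w)"
proof -
  define s t where "s = Arg2pi z" and "t = Arg2pi w"
  have b: "0 \<le> s" "s < 2 * pi" "0 \<le> t" "t < 2 * pi"
    using Arg2pi_ge_0 Arg2pi_lt_2pi by (auto simp: s_def t_def)
  have "cnj z * w = cnj (norm z * cis s) * (norm w * cis t)"
    by (simp only: s_def t_def norm_mult_cis_Arg2pi)
  then have "Im (cnj z * w) = norm z * norm w * sin (t - s)"
    by (simp add: sin_diff algebra_simps)
  moreover have "0 < norm z * norm w" using z w by simp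
  ultimately have im: "0 \<le> Im (cnj z * w) \<longleftrightarrow> 0 \<le> sin (t - s)"
    by (simp add: zero_le_mult_iff del: mult_pos_pos)
  have same: "0 \<le> sin (t - s) \<longleftrightarrow> s \<le> t" if "s < pi \<longleftrightarrow> t < pi"
  proof (cases "s \<le> t")
    case True
    then have "0 \<le> sin (t - s)" using that b by (intro sin_ge_zero) auto
    then show ?thesis using True by simp
  next
    case False
    then have "0 < sin (s - t)" using that b by (intro sin_gt_zero) auto
    then show ?thesis using False sin_minus[of "s - t"] by simp
  qed
  show ?thesis unfolding im s_def[symmetric] t_def[symmetric]
    using same b by (cases "s < pi \<longleftrightarrow> t < pi") auto
qed

text \<open>The angular condition of \<open>ccw_arc\<close> for a center at the origin, freed from
  the circle so that it can be followed through maps.\<close>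

definition in_arc :: "complex \<Rightarrow> complex \<Rightarrow> complex \<Rightarrow> bool" where
  "in_arc p a b \<longleftrightarrow> 0 < Arg2pi (p / a) \<and> Arg2pi (p / a) \<le> Arg2pi (b / a)"

lemma in_arc_scale:
  assumes "0 < r" "0 < s" "0 < t"
  shows "in_arc (p / complex_of_real r) (a / complex_of_real s) (b / complex_of_real t) \<longleftrightarrow> in_arc p a b"
proof -
  have "p / complex_of_real r / (a / complex_of_real s) = complex_of_real (s / r) * (p / a)"
    "b / complex_of_real t / (a / complex_of_real s) = complex_of_real (s / t) * (b / a)"
    by simp_all
  then show ?thesis using assms
    unfolding in_arc_def by (simp only: Arg2pi_times_of_real divide_pos_pos)
qed

lemma in_arc_mult: "u \<noteq> 0 \<Longrightarrow> in_arc (u * p) (u * a) (u * b) \<longleftrightarrow> in_arc p a b"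
  by (simp add: in_arc_def)

text \<open>The Klein model is not conformal: at the point \<open>c\<close>, the derivative of \<open>boost c\<close> stretches the
  axes differently.  Such a map preserves the cyclic order of directions because it preserves the
  signs of determinants.\<close>

lemma in_arc_stretch:
  fixes k :: real
  defines "L \<equiv> \<lambda>z. Complex (Re z) (k * Im z)"
  assumes k: "0 < k" and nz: "p \<noteq> 0" "a \<noteq> 0" "b \<noteq> 0"
  shows "in_arc (L p) (L a) (L b) \<longleftrightarrow> in_arc p a b"
proof -
  have Lnz: "L z \<noteq> 0" if "z \<noteq> 0" for z using that k by (auto simp: L_def complex_eq_iff)
  have Im_div: "Im (z / a) = Im (cnj a * z) / (norm a)\<^sup>2" for z a :: complex
    by (simp add: Im_divide cmod_power2 algebra_simps)
  have Im_L: "Im (cnj (L z) * L w) = k * Im (cnj z * w)" for z w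
    by (simp add: L_def algebra_simps)
  have sgn: "sgn (Im (L z / L a)) = sgn (Im (z / a))" for z
    unfolding Im_div Im_L using k nz Lnz[OF nz(2)] by (simp add: sgn_mult sgn_divide)
  \<comment> \<open>Real quotients are kept by real linearity; together with the sign of the
    imaginary part they decide in which half turn the argument lies.\<close>
  have real: "L z / L a = z / a" if "Im (z / a) = 0" for z
  proof -
    have za: "z / a = complex_of_real (Re (z / a))" using that by (simp add: complex_eq_iff)
    have "L (complex_of_real l * a) = complex_of_real l * L a" for l
      by (simp add: L_def complex_eq_iff)
    moreover have "z = complex_of_real (Re (z / a)) * a" unfolding za[symmetric] using nz by simp
    ultimately have "L z = complex_of_real (Re (z / a)) * L a" by metis
    then have "L z / L a = complex_of_real (Re (z / a))" using Lnz[OF nz(2)] by simp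
    also have "\<dots> = z / a" using that by (simp add: complex_eq_iff)
    finally show ?thesis .
  qed
  have pos: "0 < Arg2pi (L z / L a) \<longleftrightarrow> 0 < Arg2pi (z / a)" for z
    unfolding Arg2pi_pos_iff using sgn[of z] real[of z] by (metis sgn_zero_iff)
  have up: "Arg2pi (L z / L a) < pi \<longleftrightarrow> Arg2pi (z / a) < pi" if "z \<noteq> 0" for z
    using Arg2pi_less_pi_iff[of "L z / L a"] Arg2pi_less_pi_iff[of "z / a"] sgn[of z] real[of z]
      that nz Lnz
    by (metis divide_eq_0_iff sgn_zero_iff sgn_greater)
  have quot: "0 \<le> Im (cnj (z / a) * (w / a)) \<longleftrightarrow> 0 \<le> Im (cnj z * w)" if "a \<noteq> 0" for z w a :: complex
  proof -
    have "cnj (z / a) * (w / a) = (cnj z * w) / complex_of_real ((norm a)\<^sup>2)"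
      using complex_norm_square[of a] by (simp add: mult.commute)
    then have "Im (cnj (z / a) * (w / a)) = Im (cnj z * w) / (norm a)\<^sup>2"
      by (simp only: Im_divide_of_real)
    then show ?thesis using that by (simp add: zero_le_divide_iff)
  qed
  have "Arg2pi (L p / L a) \<le> Arg2pi (L b / L a) \<longleftrightarrow> Arg2pi (p / a) \<le> Arg2pi (b / a)"
  proof -
    have n: "L p / L a \<noteq> 0" "L b / L a \<noteq> 0" "p / a \<noteq> 0" "b / a \<noteq> 0" using nz Lnz by auto
    have "0 \<le> Im (cnj (L p) * L b) \<longleftrightarrow> 0 \<le> Im (cnj p * b)"
      unfolding Im_L using k by (simp add: zero_le_mult_iff)
    then show ?thesis
      unfolding Arg2pi_le_iff[OF n(1,2)] Arg2pi_le_iff[OF n(3,4)] up[OF nz(1)] up[OF nz(3)]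
        quot[OF nz(2)] quot[OF Lnz[OF nz(2)]] by simp
  qed
  then show ?thesis unfolding in_arc_def pos by simp
qed

text \<open>What the transport of hulls and areas requires. Orientation is not included; the cyclic
  order is followed separately in \<open>exists_hyp_motion\<close>.\<close>

definition hyp_motion :: "(complex \<Rightarrow> complex) \<Rightarrow> bool" where
  "hyp_motion f \<longleftrightarrow> bij_betw f hyp_plane hyp_plane \<and> f \<in> borel_measurable borel \<and>
     continuous_on hyp_plane f \<and>
     (\<forall>z\<in>hyp_plane. \<forall>w\<in>hyp_plane. hyp_dist (f z) (f w) = hyp_dist z w) \<and>
     (\<forall>g. g \<in> borel_measurable borel \<longrightarrow> (\<integral>\<^sup>+z. g (f z) \<partial>hyp_measure) = (\<integral>\<^sup>+z. g z \<partial>hyp_measure))"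

lemma hyp_motion_compose:
  assumes f: "hyp_motion f" and g: "hyp_motion g"
  shows "hyp_motion (\<lambda>z. g (f z))"
proof -
  have [measurable]: "f \<in> borel_measurable borel" "g \<in> borel_measurable borel"
    using f g by (auto simp: hyp_motion_def)
  have im: "f ` hyp_plane = hyp_plane" using f by (simp add: hyp_motion_def bij_betw_def)
  have "bij_betw (\<lambda>z. g (f z)) hyp_plane hyp_plane"
    using bij_betw_trans[of f hyp_plane hyp_plane g hyp_plane] f g by (simp add: hyp_motion_def o_def)
  moreover have "continuous_on hyp_plane (\<lambda>z. g (f z))"
    using f g im by (intro continuous_on_compose2[of hyp_plane g hyp_plane f]) (auto simp: hyp_motion_def)
  moreover have "hyp_dist (g (f z)) (g (f w)) = hyp_dist z w" if "z \<in> hyp_plane" "w \<in> hyp_plane" for z w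
  proof -
    have "f z \<in> hyp_plane" "f w \<in> hyp_plane" using that im by auto
    then show ?thesis using f g that by (simp add: hyp_motion_def)
  qed
  moreover have "(\<integral>\<^sup>+z. h (g (f z)) \<partial>hyp_measure) = (\<integral>\<^sup>+z. h z \<partial>hyp_measure)"
    if [measurable]: "h \<in> borel_measurable borel" for h
  proof -
    have "(\<lambda>z. h (g z)) \<in> borel_measurable borel" by measurable
    then have "(\<integral>\<^sup>+z. h (g (f z)) \<partial>hyp_measure) = (\<integral>\<^sup>+z. h (g z) \<partial>hyp_measure)"
      using f unfolding hyp_motion_def by blast
    also have "\<dots> = (\<integral>\<^sup>+z. h z \<partial>hyp_measure)" using g that unfolding hyp_motion_def by blast
    finally show ?thesis .
  qed
  ultimately show ?thesis unfolding hyp_motion_def by auto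
qed

lemma hyp_motion_rotation:
  assumes u: "norm u = 1"
  shows "hyp_motion (\<lambda>z. u * z)"
proof -
  have u': "cnj u * u = 1" using u complex_norm_square[of u] by (simp add: mult.commute)
  have "bij_betw (\<lambda>z. u * z) hyp_plane hyp_plane"
  proof (rule bij_betw_byWitness[where f'="\<lambda>z. cnj u * z"])
    show "\<forall>z\<in>hyp_plane. cnj u * (u * z) = z" "\<forall>z\<in>hyp_plane. u * (cnj u * z) = z"
      using u' by (simp_all add: mult.assoc[symmetric] mult.commute[of u])
  qed (auto simp: hyp_plane_def norm_mult u)
  moreover have "hyp_dist (u * z) (u * w) = hyp_dist z w" for z w
  proof -
    have inner_eq: "inner x y = Re (cnj x * y)" for x y :: complex
      by (simp add: inner_complex_def)
    have "inner (u * z) (u * w) = Re (cnj (u * z) * (u * w))" by (rule inner_eq)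
    also have "cnj (u * z) * (u * w) = (cnj u * u) * (cnj z * w)" by (simp add: ac_simps)
    finally have "inner (u * z) (u * w) = inner z w" unfolding inner_eq[of z w] by (simp add: u')
    then show ?thesis using u by (simp add: hyp_dist_def norm_mult)
  qed
  ultimately show ?thesis using nn_integral_hyp_measure_rotate[OF u]
    unfolding hyp_motion_def by (auto intro!: continuous_intros)
qed

lemma boost_inverse:
  assumes c: "\<bar>c\<bar> < 1" and z: "\<bar>Re z\<bar> \<le> 1"
  shows "boost (- c) (boost c z) = z"
proof -
  define P where "P = 1 - c * Re z"
  have P: "0 < P" using one_minus_mult_pos[OF c z] by (simp add: P_def)
  have c2: "0 < 1 - c\<^sup>2" using c by (simp add: abs_square_less_1)
  have D: "1 + c * ((Re z - c) / P) = (1 - c\<^sup>2) / P"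
    using P by (simp add: field_simps) (simp add: P_def power2_eq_square algebra_simps)
  have N: "(Re z - c) / P + c = Re z * ((1 - c\<^sup>2) / P)"
    using P by (simp add: field_simps) (simp add: P_def power2_eq_square algebra_simps)
  have "Re (boost (- c) (boost c z)) = ((Re z - c) / P + c) / (1 + c * ((Re z - c) / P))"
    by (simp add: boost_def P_def)
  also have "\<dots> = Re z" unfolding D N using c2 P by simp
  finally have Re: "Re (boost (- c) (boost c z)) = Re z" .
  have "Im (boost (- c) (boost c z))
      = (sqrt (1 - c\<^sup>2) * sqrt (1 - c\<^sup>2)) * Im z / P / (1 + c * ((Re z - c) / P))"
    by (simp add: boost_def P_def)
  also have "\<dots> = Im z" unfolding D using c2 P by simp
  finally show ?thesis using Re by (simp add: complex_eq_iff)
qed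

lemma hyp_motion_boost:
  assumes c: "\<bar>c\<bar> < 1"
  shows "hyp_motion (boost c)"
proof -
  have Re: "\<bar>Re z\<bar> \<le> 1" if "z \<in> hyp_plane" for z using Re_hyp_plane[OF that] by simp
  have "bij_betw (boost c) hyp_plane hyp_plane"
  proof (rule bij_betw_byWitness[where f'="boost (- c)"])
    show "\<forall>z\<in>hyp_plane. boost (- c) (boost c z) = z" using boost_inverse[OF c] Re by auto
    show "\<forall>z\<in>hyp_plane. boost c (boost (- c) z) = z"
      using boost_inverse[of "- c"] c Re by auto
    show "boost c ` hyp_plane \<subseteq> hyp_plane" using boost_in_hyp_plane_iff[OF c] Re by auto
    show "boost (- c) ` hyp_plane \<subseteq> hyp_plane"
      using boost_in_hyp_plane_iff[of "- c"] c Re by auto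
  qed
  moreover have "continuous_on hyp_plane (boost c)"
  proof -
    have "1 - c * Re z \<noteq> 0" if "z \<in> hyp_plane" for z
      using one_minus_mult_pos[OF c Re[OF that]] by simp
    then show ?thesis unfolding boost_def by (auto intro!: continuous_intros)
  qed
  moreover have "hyp_dist (boost c z) (boost c w) = hyp_dist z w"
    if z: "z \<in> hyp_plane" and w: "w \<in> hyp_plane" for z w
  proof -
    define P Q where "P = 1 - c * Re z" and "Q = 1 - c * Re w"
    have pos: "0 < P" "0 < Q" "0 < 1 - c\<^sup>2"
      using one_minus_mult_pos[OF c Re[OF z]] one_minus_mult_pos[OF c Re[OF w]] c
      by (auto simp: P_def Q_def abs_square_less_1)
    have "sqrt (1 - (norm (boost c z))\<^sup>2) * sqrt (1 - (norm (boost c w))\<^sup>2)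
        = (1 - c\<^sup>2) * (sqrt (1 - (norm z)\<^sup>2) * sqrt (1 - (norm w)\<^sup>2)) / (P * Q)"
      unfolding boost_norm[OF c Re[OF z]] boost_norm[OF c Re[OF w]] P_def[symmetric] Q_def[symmetric]
      using pos by (simp add: real_sqrt_mult real_sqrt_divide)
    moreover have "1 - inner (boost c z) (boost c w) = (1 - c\<^sup>2) * (1 - inner z w) / (P * Q)"
      using boost_inner[OF c Re[OF z] Re[OF w]] by (simp add: P_def Q_def)
    ultimately show ?thesis unfolding hyp_dist_def using pos by simp
  qed
  ultimately show ?thesis using nn_integral_hyp_measure_boost[OF c]
    unfolding hyp_motion_def by auto
qed

lemma hyp_convexI:
  assumes "S \<subseteq> hyp_plane" "\<And>z w u. z \<in> S \<Longrightarrow> w \<in> S \<Longrightarrow> u \<in> hyp_segment z w \<Longrightarrow> u \<in> S"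
  shows "hyp_convex S"
  unfolding hyp_convex_def using assms by blast

lemma hyp_convexD: "hyp_convex S \<Longrightarrow> z \<in> S \<Longrightarrow> w \<in> S \<Longrightarrow> u \<in> hyp_segment z w \<Longrightarrow> u \<in> S"
  unfolding hyp_convex_def by blast

text \<open>Segments are defined by distances alone, so both images and preimages under
  \<open>f\<close> of convex sets are convex, and minimality of the hull gives each
  inclusion.\<close>

lemma hyp_motion_hull:
  assumes f: "hyp_motion f" and X: "X \<subseteq> hyp_plane"
  shows "f ` (hyp_convex hull X) = hyp_convex hull (f ` X)"
proof
  have im: "f ` hyp_plane = hyp_plane" using f by (simp add: hyp_motion_def bij_betw_def)
  have dist: "hyp_dist (f z) (f w) = hyp_dist z w" if "z \<in> hyp_plane" "w \<in> hyp_plane" for z w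
    using f that by (simp add: hyp_motion_def)
  have hull_convex: "hyp_convex (hyp_convex hull Y)" if "Y \<subseteq> hyp_plane" for Y
  proof -
    have "convex hull Y \<subseteq> hyp_plane"
      using that by (intro hull_minimal) (auto simp: hyp_plane_def)
    then show ?thesis by (simp add: hyp_convex_hull_eq[OF that] hyp_convex_iff)
  qed
  have fX: "f ` X \<subseteq> hyp_plane" using X im by blast
  show "hyp_convex hull (f ` X) \<subseteq> f ` (hyp_convex hull X)"
  proof (rule hull_minimal)
    show "f ` X \<subseteq> f ` (hyp_convex hull X)" by (intro image_mono hull_subset)
    have H: "hyp_convex hull X \<subseteq> hyp_plane" using hull_convex[OF X] by (simp add: hyp_convex_iff)
    show "hyp_convex (f ` (hyp_convex hull X))"
    proof (rule hyp_convexI)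
      show "f ` (hyp_convex hull X) \<subseteq> hyp_plane" using H im by blast
    next
      fix z w u assume z: "z \<in> f ` (hyp_convex hull X)" and w: "w \<in> f ` (hyp_convex hull X)"
        and u: "u \<in> hyp_segment z w"
      obtain z' w' where zw: "z' \<in> hyp_convex hull X" "z = f z'" "w' \<in> hyp_convex hull X" "w = f w'"
        using z w by auto
      have "u \<in> hyp_plane" using u by (simp add: hyp_segment_def)
      then obtain u' where u': "u' \<in> hyp_plane" "u = f u'" using im by (metis imageE)
      have "z' \<in> hyp_plane" "w' \<in> hyp_plane" using zw H by auto
      then have "u' \<in> hyp_segment z' w'"
        using u u' zw dist[of z' u'] dist[of u' w'] dist[of z' w'] by (simp add: hyp_segment_def)
      then have "u' \<in> hyp_convex hull X"
        using hyp_convexD[OF hull_convex[OF X]] zw by blast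
      then show "u \<in> f ` (hyp_convex hull X)" using u' by simp
    qed
  qed
  have "hyp_convex hull X \<subseteq> {z \<in> hyp_plane. f z \<in> hyp_convex hull (f ` X)}"
  proof (rule hull_minimal)
    show "X \<subseteq> {z \<in> hyp_plane. f z \<in> hyp_convex hull (f ` X)}"
      using X by (auto intro: hull_inc)
    show "hyp_convex {z \<in> hyp_plane. f z \<in> hyp_convex hull (f ` X)}"
    proof (rule hyp_convexI)
      fix z w u assume z: "z \<in> {z \<in> hyp_plane. f z \<in> hyp_convex hull (f ` X)}"
        and w: "w \<in> {z \<in> hyp_plane. f z \<in> hyp_convex hull (f ` X)}" and u: "u \<in> hyp_segment z w"
      have "f u \<in> hyp_segment (f z) (f w)"
        using u z w im dist[of z u] dist[of u w] dist[of z w] by (auto simp: hyp_segment_def)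
      then have "f u \<in> hyp_convex hull (f ` X)"
        using hyp_convexD[OF hull_convex[OF fX]] z w by blast
      then show "u \<in> {z \<in> hyp_plane. f z \<in> hyp_convex hull (f ` X)}"
        using u by (simp add: hyp_segment_def)
    qed auto
  qed
  then show "f ` (hyp_convex hull X) \<subseteq> hyp_convex hull (f ` X)" by auto
qed

lemma hyp_motion_hull_area:
  assumes f: "hyp_motion f" and X: "X \<subseteq> hyp_plane" "finite X"
  shows "hyp_area (hyp_convex hull (f ` X)) = hyp_area (hyp_convex hull X)"
proof -
  have K: "compact (convex hull X)" using X by (intro compact_convex_hull finite_imp_compact)
  have sub: "convex hull X \<subseteq> hyp_plane"
    using X by (intro hull_minimal) (auto simp: hyp_plane_def)
  have "continuous_on hyp_plane f" using f by (simp add: hyp_motion_def)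
  then have fK: "compact (f ` (convex hull X))"
    by (intro compact_continuous_image K continuous_on_subset[OF _ sub])
  have "hyp_area (f ` (convex hull X)) = hyp_area (convex hull X)"
  proof (rule hyp_area_image[OF _ _ _ _ _ sub])
    show "f \<in> borel_measurable borel" "inj_on f hyp_plane" "f ` hyp_plane \<subseteq> hyp_plane"
      using f by (simp_all add: hyp_motion_def bij_betw_def)
    show "(\<integral>\<^sup>+z. g (f z) \<partial>hyp_measure) = (\<integral>\<^sup>+z. g z \<partial>hyp_measure)" if "g \<in> borel_measurable borel" for g
      using f that unfolding hyp_motion_def by blast
    show "convex hull X \<in> sets borel" "f ` (convex hull X) \<in> sets borel"
      using K fK by (simp_all add: compact_imp_closed borel_closed)
  qed
  then show ?thesis
    using hyp_motion_hull[OF f X(1)] hyp_convex_hull_eq[OF X(1)] by simp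
qed

text \<open>The rotation by \<open>u\<close> brings \<open>c\<close> onto the real axis, and a boost
  then takes it to 0.\<close>

lemma exists_hyp_motion:
  assumes c: "c \<in> hyp_plane"
  shows "\<exists>f. hyp_motion f \<and> f c = 0 \<and>
    (\<forall>p\<in>hyp_plane - {c}. \<forall>a\<in>hyp_plane - {c}. \<forall>b\<in>hyp_plane - {c}.
       in_arc (f p) (f a) (f b) \<longleftrightarrow> in_arc (p - c) (a - c) (b - c))"
proof -
  define v where "v = norm c"
  define \<psi> where "\<psi> = Arg2pi c"
  define u where "u = cis (- \<psi>)"
  have v: "\<bar>v\<bar> < 1" using c by (simp add: v_def hyp_plane_def)
  have u: "norm u = 1" "u \<noteq> 0" by (auto simp: u_def)
  have "u * (complex_of_real v * cis \<psi>) = complex_of_real v"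
    by (simp add: u_def cis_mult mult.left_commute)
  then have uc: "u * c = complex_of_real v"
    unfolding v_def \<psi>_def norm_mult_cis_Arg2pi .
  define f where "f = (\<lambda>z. boost v (u * z))"
  have "hyp_motion f"
    unfolding f_def by (rule hyp_motion_compose[OF hyp_motion_rotation[OF u(1)] hyp_motion_boost[OF v]])
  moreover have "f c = 0" by (simp only: f_def uc) (simp add: boost_def complex_eq_iff)
  moreover have "in_arc (f p) (f a) (f b) \<longleftrightarrow> in_arc (p - c) (a - c) (b - c)"
    if "p \<in> hyp_plane - {c}" "a \<in> hyp_plane - {c}" "b \<in> hyp_plane - {c}" for p a b
  proof -
    define k where "k = sqrt (1 - v\<^sup>2)"
    have k: "0 < k" using v by (simp add: k_def abs_square_less_1)
    \<comment> \<open>The denominator is a positive real, which does not affect directions. Up to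
      it, \<open>f\<close> is linear in \<open>z - c\<close>: a rotation followed by a stretch of
      the imaginary axis.\<close>
    have fz: "f z = Complex (Re (u * (z - c))) (k * Im (u * (z - c))) / complex_of_real (1 - v * Re (u * z))" for z
    proof -
      have "u * (z - c) = u * z - complex_of_real v" by (simp add: right_diff_distrib uc)
      then show ?thesis by (simp add: f_def boost_def k_def complex_eq_iff)
    qed
    have pos: "0 < 1 - v * Re (u * z)" if "z \<in> hyp_plane" for z
      using that u Re_hyp_plane[of "u * z"] by (intro one_minus_mult_pos v) (auto simp: hyp_plane_def norm_mult)
    define L where "L = (\<lambda>z. Complex (Re z) (k * Im z))"
    have "in_arc (f p) (f a) (f b) \<longleftrightarrow> in_arc (L (u * (p - c))) (L (u * (a - c))) (L (u * (b - c)))"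
      unfolding fz L_def using that by (intro in_arc_scale pos) auto
    also have "\<dots> \<longleftrightarrow> in_arc (u * (p - c)) (u * (a - c)) (u * (b - c))"
      unfolding L_def using that u by (intro in_arc_stretch k) auto
    also have "\<dots> \<longleftrightarrow> in_arc (p - c) (a - c) (b - c)"
      by (rule in_arc_mult[OF u(2)])
    finally show ?thesis .
  qed
  ultimately show ?thesis by blast
qed

section \<open>Cyclic polygons\<close>

text \<open>A motion puts the center at 0 and vertex 0 on the positive real axis; the arguments of
  the vertices then increase. As \<open>d i\<close> is the side ending at vertex \<open>i\<close>,
  the gap from \<open>b i\<close> to \<open>b (Suc i)\<close> belongs to the side with index
  \<open>Suc i mod n\<close>.\<close>

lemma cyclic_ngon_normal_form:
  assumes n: "2 \<le> n" and d: "\<And>i. i < n \<Longrightarrow> 0 < d i" and ngon: "cyclic_ngon n d x"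
  shows "\<exists>r>0. \<exists>b :: nat \<Rightarrow> real. b 0 = 0 \<and> b n = 2 * pi \<and> (\<forall>i<n. b i < b (Suc i)) \<and>
    (\<forall>i<n. d (Suc i mod n) = 2 * arsinh (sinh r * sin ((b (Suc i) - b i) / 2))) \<and>
    hyp_area (hyp_convex hull (x ` {..<n})) =
      hyp_area (hyp_convex hull ((\<lambda>i. complex_of_real (tanh r) * cis (b i)) ` {..<n}))"
proof -
  obtain c r where c: "c \<in> hyp_plane" and r: "0 < r"
    and ngon': "\<forall>i<n. x i \<in> hyp_circle c r"
      "\<forall>i\<in>{1..<n}. \<forall>j<n. j \<noteq> i \<longrightarrow> x j \<notin> ccw_arc c r (x (i - 1)) (x i)"
      "\<forall>i\<in>{1..<n}. hyp_dist (x (i - 1)) (x i) = d i"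
      "hyp_dist (x (n - 1)) (x 0) = d 0"
    using ngon unfolding cyclic_ngon_def by (elim conjE bexE exE) (rule that)
  have circ: "x i \<in> hyp_circle c r" if "i < n" for i using ngon'(1) that by simp
  have arc: "x j \<notin> ccw_arc c r (x (i - 1)) (x i)" if "i \<in> {1..<n}" "j < n" "j \<noteq> i" for i j
    using ngon'(2) that by simp
  have side: "hyp_dist (x (i - 1)) (x i) = d i" if "i \<in> {1..<n}" for i using ngon'(3) that by simp
  note side_0 = ngon'(4)
  have x: "x i \<in> hyp_plane - {c}" if "i < n" for i
    using circ[OF that] r hyp_dist_self[OF c] by (auto simp: hyp_circle_def)
  obtain f where f: "hyp_motion f" "f c = 0"
    and f_arc: "\<And>p a b. p \<in> hyp_plane - {c} \<Longrightarrow> a \<in> hyp_plane - {c} \<Longrightarrow> b \<in> hyp_plane - {c} \<Longrightarrow>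
       in_arc (f p) (f a) (f b) \<longleftrightarrow> in_arc (p - c) (a - c) (b - c)"
    using exists_hyp_motion[OF c] by blast
  define \<rho> where "\<rho> = tanh r"
  have \<rho>: "0 < \<rho>" using r by (simp add: \<rho>_def)
  have norm_f: "norm (f (x i)) = \<rho>" if "i < n" for i
  proof -
    have "f (x i) \<in> hyp_plane" using f x[OF that] by (auto simp: hyp_motion_def bij_betw_def)
    moreover have "hyp_dist (f c) (f (x i)) = hyp_dist c (x i)"
      using f(1) c x[OF that] unfolding hyp_motion_def by blast
    ultimately have "f (x i) \<in> hyp_circle 0 r"
      using circ[OF that] f(2) by (simp add: hyp_circle_def)
    then show ?thesis by (simp add: hyp_circle_0[OF r] \<rho>_def)
  qed
  define u where "u = cis (- Arg2pi (f (x 0)))"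
  have u: "norm u = 1" "u \<noteq> 0" by (auto simp: u_def)
  define y where "y = (\<lambda>i. u * f (x i))"
  have motion: "hyp_motion (\<lambda>z. u * f z)"
    by (rule hyp_motion_compose[OF f(1) hyp_motion_rotation[OF u(1)]])
  define \<beta> where "\<beta> = (\<lambda>i. Arg2pi (y i))"
  have y: "y i = complex_of_real \<rho> * cis (\<beta> i)" if "i < n" for i
    using norm_mult_cis_Arg2pi[of "y i"] norm_f[OF that] u by (simp add: y_def \<beta>_def norm_mult)
  have \<beta>: "0 \<le> \<beta> i" "\<beta> i < 2 * pi" for i
    using Arg2pi_ge_0 Arg2pi_lt_2pi by (auto simp: \<beta>_def)
  have "y 0 = u * (complex_of_real \<rho> * cis (Arg2pi (f (x 0))))"
    using norm_mult_cis_Arg2pi[of "f (x 0)"] norm_f[of 0] n by (simp add: y_def)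
  then have y0: "y 0 = complex_of_real \<rho>"
    by (simp add: u_def mult.left_commute cis_mult)
  then have \<beta>0: "\<beta> 0 = 0" using \<rho> Arg2pi_of_real[of \<rho>] by (simp add: \<beta>_def)
  have quot: "y i / y j = cis (\<beta> i - \<beta> j)" if "i < n" "j < n" for i j
    using \<rho> by (simp add: y that cis_divide[symmetric])
  have dist: "hyp_dist (x i) (x j) = 2 * arsinh \<bar>sinh r * sin ((\<beta> j - \<beta> i) / 2)\<bar>" if "i < n" "j < n" for i j
  proof -
    have "hyp_dist (x i) (x j) = hyp_dist (y i) (y j)"
      using motion x that unfolding hyp_motion_def y_def by simp
    then show ?thesis using that by (simp add: y \<rho>_def hyp_dist_on_circle)
  qed
  \<comment> \<open>If the argument decreased from \<open>i - 1\<close> to \<open>i\<close>, the arc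
    between them would run through the angle 0 and contain vertex 0. It cannot stay the same because
    the side has positive length.\<close>
  have \<beta>_less: "\<beta> (i - 1) < \<beta> i" if i: "i \<in> {1..<n}" for i
  proof (rule ccontr)
    assume "\<not> \<beta> (i - 1) < \<beta> i"
    moreover have "\<beta> (i - 1) \<noteq> \<beta> i"
      using side[OF i] d[of i] dist[of "i - 1" i] i by auto
    ultimately have less: "\<beta> i < \<beta> (i - 1)" by simp
    have i': "i < n" "i - 1 < n" "0 < n" using i by auto
    have "Arg2pi (cis (2 * pi - \<beta> (i - 1))) = 2 * pi - \<beta> (i - 1)"
      using Arg2pi_mult_cis[of 1 "2 * pi - \<beta> (i - 1)"] less \<beta>[of i] \<beta>[of "i - 1"] by simp
    moreover have "Arg2pi (cis (2 * pi + \<beta> i - \<beta> (i - 1))) = 2 * pi + \<beta> i - \<beta> (i - 1)"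
      using Arg2pi_mult_cis[of 1 "2 * pi + \<beta> i - \<beta> (i - 1)"] less \<beta>[of i] \<beta>[of "i - 1"] by simp
    moreover have "cis (2 * pi + t) = cis t" for t by (simp add: cis_mult[symmetric])
    then have "cis (2 * pi - \<beta> (i - 1)) = y 0 / y (i - 1)"
      "cis (2 * pi + \<beta> i - \<beta> (i - 1)) = y i / y (i - 1)"
      using quot[OF i'(3,2)] quot[OF i'(1,2)] \<beta>0 by (simp_all add: diff_conv_add_uminus add.assoc del: add_uminus_conv_diff)
    ultimately have "in_arc (y 0) (y (i - 1)) (y i)"
      using \<beta>[of i] \<beta>[of "i - 1"] less by (simp add: in_arc_def)
    then have "in_arc (x 0 - c) (x (i - 1) - c) (x i - c)"
      using f_arc x i' u by (simp add: y_def in_arc_mult)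
    then have "x 0 \<in> ccw_arc c r (x (i - 1)) (x i)"
      using circ[OF i'(3)] by (simp add: ccw_arc_def in_arc_def)
    then show False using arc[OF i, of 0] i by auto
  qed
  define b where "b = (\<lambda>i. if i < n then \<beta> i else 2 * pi)"
  have b_less: "b i < b (Suc i)" if "i < n" for i
    using \<beta>_less[of "Suc i"] \<beta>(2)[of i] that by (auto simp: b_def)
  have b_range: "0 \<le> b i" "b i \<le> 2 * pi" for i using \<beta>[of i] by (auto simp: b_def)
  have sides: "d (Suc i mod n) = 2 * arsinh (sinh r * sin ((b (Suc i) - b i) / 2))" if i: "i < n" for i
  proof -
    have "0 < sin ((b (Suc i) - b i) / 2)"
    proof (rule sin_gt_zero)
      show "0 < (b (Suc i) - b i) / 2" using b_less[OF i] by simp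
      have "b (Suc i) - b i \<noteq> 2 * pi"
      proof
        assume "b (Suc i) - b i = 2 * pi"
        then have "b i = 0" "b (Suc i) = 2 * pi" using b_range[of i] b_range[of "Suc i"] by auto
        then have "\<not> Suc i < n" using \<beta>(2)[of "Suc i"] by (auto simp: b_def)
        then have "i = n - 1" using i by simp
        moreover have "n - 1 \<in> {1..<n}" using n by auto
        then have "0 < \<beta> (n - 1)" using \<beta>_less[of "n - 1"] \<beta>(1)[of "n - 1 - 1"] by linarith
        ultimately show False using \<open>b i = 0\<close> i by (simp add: b_def)
      qed
      then show "(b (Suc i) - b i) / 2 < pi" using b_range[of i] b_range[of "Suc i"] by auto
    qed
    then have abs: "\<bar>sinh r * sin ((b (Suc i) - b i) / 2)\<bar> = sinh r * sin ((b (Suc i) - b i) / 2)"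
      using r by (simp add: abs_mult)
    show ?thesis
    proof (cases "Suc i < n")
      case True
      then have "d (Suc i mod n) = hyp_dist (x i) (x (Suc i))" using side[of "Suc i"] by simp
      also have "\<dots> = 2 * arsinh \<bar>sinh r * sin ((b (Suc i) - b i) / 2)\<bar>"
        using dist[of i "Suc i"] True by (simp add: b_def)
      finally show ?thesis unfolding abs .
    next
      case False
      then have i': "i = n - 1" "Suc i = n" using i by auto
      then have "d (Suc i mod n) = hyp_dist (x i) (x 0)" using side_0 by simp
      also have "\<dots> = 2 * arsinh \<bar>sinh r * sin ((0 - \<beta> i) / 2)\<bar>"
        using dist[of i 0] i \<beta>0 by simp
      also have "sin ((0 - \<beta> i) / 2) = - sin ((b (Suc i) - b i) / 2)"
      proof -
        have "(b (Suc i) - b i) / 2 = pi - \<beta> i / 2" using i i' by (simp add: b_def field_simps)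
        then show ?thesis by (simp only: sin_diff) simp
      qed
      finally show ?thesis using abs by simp
    qed
  qed
  have "hyp_area (hyp_convex hull ((\<lambda>z. u * f z) ` (x ` {..<n}))) = hyp_area (hyp_convex hull (x ` {..<n}))"
    by (rule hyp_motion_hull_area[OF motion]) (use x in auto)
  moreover have "(\<lambda>z. u * f z) ` (x ` {..<n}) = (\<lambda>i. complex_of_real (tanh r) * cis (b i)) ` {..<n}"
    unfolding image_image by (intro image_cong) (use y in \<open>auto simp: b_def y_def \<rho>_def\<close>)
  ultimately have "hyp_area (hyp_convex hull (x ` {..<n})) =
      hyp_area (hyp_convex hull ((\<lambda>i. complex_of_real (tanh r) * cis (b i)) ` {..<n}))" by simp
  moreover have "b 0 = 0" "b n = 2 * pi" using n \<beta>0 by (auto simp: b_def)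
  ultimately show ?thesis using r b_less sides by blast
qed

text \<open>The converse of the normal form. It supplies the polygon whose existence gives the
  description in \<open>D0\<close> a value.\<close>

lemma cyclic_ngon_on_circle:
  assumes n: "2 \<le> n" and r: "0 < r" and b: "b 0 = 0" "b n = 2 * pi" "\<And>i. i < n \<Longrightarrow> b i < b (Suc i)"
    and d: "\<And>i. i < n \<Longrightarrow> d (Suc i mod n) = 2 * arsinh (sinh r * sin ((b (Suc i) - b i) / 2))"
  shows "cyclic_ngon n d (\<lambda>i. complex_of_real (tanh r) * cis (b i))"
proof -
  define y where "y = (\<lambda>i. complex_of_real (tanh r) * cis (b i))"
  have less: "b i < b j" if "i < j" "j \<le> n" for i j
    using that
  proof (induction j)
    case (Suc j)
    then show ?case using b(3)[of j] by (cases "i = j") auto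
  qed simp
  have range: "0 \<le> b i" "b i < 2 * pi" if "i < n" for i
    using less[of 0 i] less[of i n] that b by (cases "i = 0"; simp)+
  have quot: "y i / y j = cis (b i - b j)" for i j
    using r by (simp add: y_def cis_divide[symmetric])
  have dist: "hyp_dist (y i) (y (Suc i)) = d (Suc i mod n)" if i: "i < n" for i
  proof -
    have "b (Suc i) \<le> 2 * pi" using less[of "Suc i" n] i b by (cases "Suc i = n") auto
    then have "0 \<le> sin ((b (Suc i) - b i) / 2)"
      using b(3)[OF i] range[OF i] by (intro sin_ge_zero) auto
    then show ?thesis using r by (simp add: y_def hyp_dist_on_circle d[OF i])
  qed
  have yn: "y n = y 0" by (simp add: y_def b)
  have out: "y j \<notin> ccw_arc 0 r (y (i - 1)) (y i)" if i: "i \<in> {1..<n}" and j: "j < n" "j \<noteq> i" for i j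
  proof
    assume "y j \<in> ccw_arc 0 r (y (i - 1)) (y i)"
    then have arc: "0 < Arg2pi (cis (b j - b (i - 1)))"
      "Arg2pi (cis (b j - b (i - 1))) \<le> Arg2pi (cis (b i - b (i - 1)))"
      by (simp_all add: ccw_arc_def quot)
    have i': "i < n" "i - 1 < n" using i by auto
    have bi: "b (i - 1) < b i" using less[of "i - 1" i] i by simp
    have gi: "Arg2pi (cis (b i - b (i - 1))) = b i - b (i - 1)"
      using Arg2pi_mult_cis[of 1 "b i - b (i - 1)"] bi range[OF i'(1)] range[OF i'(2)] by simp
    show False
    proof (cases "j \<le> i - 1")
      case True
      show False
      proof (cases "j = i - 1")
        case False
        then have bj: "b j < b (i - 1)" using True less[of j "i - 1"] i' by simp
        have "cis (b j - b (i - 1)) = cis (2 * pi + (b j - b (i - 1)))" by (simp add: cis_mult[symmetric])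
        also have "Arg2pi \<dots> = 2 * pi + (b j - b (i - 1))"
          using Arg2pi_mult_cis[of 1 "2 * pi + (b j - b (i - 1))"] bj range[OF i'(2)] range[OF j(1)] by simp
        finally have "2 * pi + b j \<le> b i" using arc(2) gi by simp
        then show False using range[OF i'(1)] range[OF j(1)] by simp
      qed (use arc(1) Arg2pi_of_real[of 1] in simp)
    next
      case False
      then have bj: "b i < b j" using less[of i j] j by simp
      have "Arg2pi (cis (b j - b (i - 1))) = b j - b (i - 1)"
        using Arg2pi_mult_cis[of 1 "b j - b (i - 1)"] bi bj range[OF j(1)] range[OF i'(2)] by simp
      then show False using arc(2) gi bj by simp
    qed
  qed
  have "\<forall>i<n. y i \<in> hyp_circle 0 r" using r by (simp add: hyp_circle_0 y_def norm_mult)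
  moreover have "0 \<in> hyp_plane" by (simp add: hyp_plane_def)
  moreover have "hyp_dist (y (i - 1)) (y i) = d i" if "i \<in> {1..<n}" for i
  proof -
    have "i - 1 < n" "Suc (i - 1) = i" using that by auto
    then show ?thesis using dist[of "i - 1"] that by simp
  qed
  moreover have "hyp_dist (y (n - 1)) (y 0) = d 0"
    using dist[of "n - 1"] n yn by simp
  ultimately have "cyclic_ngon n d y"
    unfolding cyclic_ngon_def using out r by blast
  then show ?thesis by (simp add: y_def)
qed

section \<open>From the side lengths to the circumradius and the area\<close>

lemma sum_cyclic_shift:
  fixes F :: "nat \<Rightarrow> real"
  assumes "0 < n"
  shows "(\<Sum>i<n. F (Suc i mod n)) = (\<Sum>i<n. F i)"
proof -
  obtain m where m: "n = Suc m" using assms by (cases n) auto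
  have "(\<Sum>i<n. F (Suc i mod n)) = (\<Sum>i<m. F (Suc i mod n)) + F 0"
    by (simp add: m)
  also have "(\<Sum>i<m. F (Suc i mod n)) = (\<Sum>i<m. F (Suc i))"
    by (intro sum.cong) (simp_all add: m)
  also have "(\<Sum>i<m. F (Suc i)) + F 0 = (\<Sum>i<n. F i)"
    unfolding m sum.lessThan_Suc_shift by simp
  finally show ?thesis .
qed

text \<open>A gap larger than \<open>pi\<close> belongs to the longest side.  Seen from a circle having that side as
  its diameter, the other sides would span less than a half turn, because
  \<open>arcsin (sin a / sin B)\<close> lies below its chord \<open>a * (pi / 2 / B)\<close> for \<open>a\<close> between \<open>0\<close> and \<open>B\<close>.\<close>

lemma half_gaps_le:
  fixes s h :: "nat \<Rightarrow> real"
  assumes n: "3 \<le> n" and R: "0 < R" and s: "\<And>i. i < n \<Longrightarrow> s i = R * sin (h i)"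
    and h: "\<And>i. i < n \<Longrightarrow> 0 < h i" "(\<Sum>i<n. h i) = pi"
    and M: "m < n" "\<And>i. i < n \<Longrightarrow> s i \<le> s m" and ge: "pi \<le> (\<Sum>i<n. arcsin (s i / s m))"
    and k: "k < n"
  shows "h k \<le> pi / 2"
proof (rule ccontr)
  assume "\<not> h k \<le> pi / 2"
  then have hk: "pi / 2 < h k" by simp
  \<comment> \<open>The total of the other half gaps, with \<open>sin B = sin (h k)\<close>. As
    \<open>n >= 3\<close> leaves at least two others, each of them is strictly below
    \<open>B\<close>; hence side \<open>k\<close> is longest and the chord estimate applies to the
    rest.\<close>
  define B where "B = pi - h k"
  define I where "I = {..<n} - {k}"
  have I: "finite I" "(\<Sum>i\<in>I. h i) = B"
    using h(2) k by (auto simp: I_def B_def sum_diff1)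
  have "card I = n - 1" using k by (simp add: I_def)
  then have I_card: "2 \<le> card I" using n by simp
  have hB: "0 < h i \<and> h i < B" if "i \<in> I" for i
  proof -
    have "I - {i} \<noteq> {}" using I_card that by (metis I(1) One_nat_def card.empty card_Suc_Diff1 not_less_eq_eq numeral_2_eq_2 order_refl)
    then have "0 < (\<Sum>j\<in>I - {i}. h j)" using I(1) h(1) by (intro sum_pos) (auto simp: I_def)
    moreover have "(\<Sum>j\<in>I. h j) = h i + (\<Sum>j\<in>I - {i}. h j)" using I(1) that by (rule sum.remove)
    ultimately show ?thesis using I(2) h(1) that by (auto simp: I_def)
  qed
  have "I \<noteq> {}" using I_card by auto
  then have B: "0 < B" "B < pi / 2" using hB hk by (fastforce simp: B_def)+
  have sB: "0 < sin B" using B by (intro sin_gt_zero) auto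
  have sk: "s k = R * sin B" using s[OF k] by (simp add: B_def)
  have "s i \<le> s k" if "i < n" for i
  proof (cases "i = k")
    case False
    then have "sin (h i) \<le> sin B" using hB[of i] that B by (intro sin_monotone_2pi_le) (auto simp: I_def)
    then show ?thesis using R s[OF that] sk by simp
  qed simp
  then have sm: "s m = s k" using M k by (meson antisym)
  have "(\<Sum>i\<in>I. arcsin (s i / s m)) < (\<Sum>i\<in>I. h i * (pi / 2 / B))"
  proof (rule sum_strict_mono)
    fix i assume i: "i \<in> I"
    have "s i / s m = sin (h i) / sin B" unfolding sm sk using s[of i] i R by (simp add: I_def)
    then show "arcsin (s i / s m) < h i * (pi / 2 / B)"
      using arcsin_sin_ratio_less[of "h i" B] hB[OF i] B by simp
  qed (use I \<open>I \<noteq> {}\<close> in auto)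
  also have "\<dots> = B * (pi / 2 / B)" unfolding I(2)[symmetric] by (rule sum_distrib_right[symmetric])
  also have "\<dots> = pi / 2" using B by simp
  finally have "(\<Sum>i\<in>I. arcsin (s i / s m)) < pi / 2" .
  moreover have "(\<Sum>i<n. arcsin (s i / s m)) = arcsin (s k / s m) + (\<Sum>i\<in>I. arcsin (s i / s m))"
    unfolding I_def using k by (intro sum.remove) auto
  moreover have "arcsin (s k / s m) = pi / 2" using sm sk R sB by simp
  ultimately show False using ge by simp
qed

lemma circumradius_unique:
  fixes s :: "nat \<Rightarrow> real"
  assumes "0 < n" "\<And>i. i < n \<Longrightarrow> 0 < s i \<and> s i \<le> R \<and> s i \<le> R'"
    and "(\<Sum>i<n. arcsin (s i / R)) = pi" "(\<Sum>i<n. arcsin (s i / R')) = pi"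
  shows "R = R'"
proof -
  have less: "(\<Sum>i<n. arcsin (s i / R')) < (\<Sum>i<n. arcsin (s i / R))"
    if "R < R'" "\<And>i. i < n \<Longrightarrow> 0 < s i \<and> s i \<le> R" for R R'
  proof (rule sum_strict_mono)
    fix i assume "i \<in> {..<n}"
    then have i: "0 < s i" "s i \<le> R" using that by auto
    then have "s i / R' < s i / R" "0 \<le> s i / R'" "s i / R \<le> 1"
      using that(1) by (auto intro: divide_strict_left_mono)
    then show "arcsin (s i / R') < arcsin (s i / R)" by (intro arcsin_strict_mono)
  qed (use assms(1) in auto)
  show ?thesis using less[of R R'] less[of R' R] assms by fastforce
qed

lemma polygon_area_formula:
  assumes n: "0 < n" and r: "0 < r" and b: "b 0 = 0" "b n = 2 * pi"
    and gap: "\<And>i. i < n \<Longrightarrow> b i < b (Suc i) \<and> b (Suc i) \<le> b i + pi"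
    and d: "\<And>i. i < n \<Longrightarrow> d (Suc i mod n) = 2 * arsinh (sinh r * sin ((b (Suc i) - b i) / 2))"
  shows "hyp_area (hyp_convex hull ((\<lambda>i. complex_of_real (tanh r) * cis (b i)) ` {..<n}))
    = 2 * (\<Sum>i<n. arcsin (tanh (d i / 2) / tanh r)) - 2 * pi"
proof -
  interpret centered_polygon n b "tanh r"
    by unfold_locales (use r b gap in auto)
  have "(\<lambda>i. complex_of_real (tanh r) * cis (b i)) ` {..<n} \<subseteq> hyp_plane"
    using r tanh_real_lt_1[of r] by (auto simp: hyp_plane_def norm_mult)
  then have "hyp_area (hyp_convex hull ((\<lambda>i. complex_of_real (tanh r) * cis (b i)) ` {..<n})) = hyp_area polygon"
    by (simp add: hyp_convex_hull_eq polygon_def)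
  also have "\<dots> = 2 * (\<Sum>i<n. arcsin (tanh (d (Suc i mod n) / 2) / tanh r)) - 2 * pi"
    by (rule hyp_area_polygon[OF r refl]) (simp add: d half_def)
  also have "(\<Sum>i<n. arcsin (tanh (d (Suc i mod n) / 2) / tanh r)) = (\<Sum>i<n. arcsin (tanh (d i / 2) / tanh r))"
    by (rule sum_cyclic_shift[OF n, of "\<lambda>i. arcsin (tanh (d i / 2) / tanh r)"])
  finally show ?thesis .
qed

text \<open>For any polygon with these sides, half gaps of at most \<open>pi / 2\<close> make its
  radius a solution of the equation that defines \<open>J\<close>, so the radius is \<open>J\<close>
  and the area is the stated one. Conversely the angles at radius \<open>J\<close> build such a
  polygon.\<close>

lemma D0_formula:
  assumes n: "3 \<le> n" and d: "d \<in> C_set n \<union> BC_set n"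
  shows "\<exists>J>0. (\<forall>i<n. 0 < d i \<and> d i / 2 \<le> J) \<and> (\<Sum>i<n. arcsin (sinh (d i / 2) / sinh J)) = pi \<and>
    D0 n d = 2 * (\<Sum>i<n. arcsin (tanh (d i / 2) / tanh J)) - 2 * pi"
proof -
  define D where "D = Max (d ` {..<n})"
  define s where "s = (\<lambda>i. sinh (d i / 2))"
  have d0: "0 < d i" if "i < n" for i using d that by (auto simp: C_set_def BC_set_def)
  have dD: "d i \<le> D" if "i < n" for i unfolding D_def using that by (intro Max_ge) auto
  have "D \<in> d ` {..<n}" unfolding D_def using n by (intro Max_in) (auto simp: lessThan_empty_iff)
  then obtain m where m: "m < n" "d m = D" by auto
  have "2 * pi \<le> (\<Sum>i<n. \<theta> (d i) (D / 2))" using d by (auto simp: C_set_def BC_set_def D_def)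
  then have ge: "pi \<le> (\<Sum>i<n. arcsin (s i / s m))"
    by (simp add: \<theta>_def s_def m flip: sum_distrib_left)
  have D: "0 < D" using d0[OF m(1)] m by simp
  obtain J where J: "D / 2 \<le> J" "(\<Sum>i<n. arcsin (s i / sinh J)) = pi"
    using exists_circumradius[of n "D / 2" "\<lambda>i. d i / 2"] n D d0 dD ge by (auto simp: s_def m)
  have J0: "0 < J" using J D by simp
  have sJ: "0 < s i \<and> s i \<le> sinh J" if "i < n" for i
    using d0[OF that] dD[OF that] J by (simp add: s_def)
  define V where "V = 2 * (\<Sum>i<n. arcsin (tanh (d i / 2) / tanh J)) - 2 * pi"
  have unique: "A = V" if ngon: "cyclic_ngon n d x" and A: "A = hyp_area (hyp_convex hull (x ` {..<n}))" for x A
  proof -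
    obtain r b where r: "0 < r" and b: "b 0 = 0" "b n = 2 * pi" "\<And>i. i < n \<Longrightarrow> b i < b (Suc i)"
      and sides: "\<And>i. i < n \<Longrightarrow> d (Suc i mod n) = 2 * arsinh (sinh r * sin ((b (Suc i) - b i) / 2))"
      and area: "hyp_area (hyp_convex hull (x ` {..<n})) =
        hyp_area (hyp_convex hull ((\<lambda>i. complex_of_real (tanh r) * cis (b i)) ` {..<n}))"
      using cyclic_ngon_normal_form[OF _ d0 ngon] n by auto
    define h where "h = (\<lambda>i. (b (Suc i) - b i) / 2)"
    have h0: "0 < h i" if "i < n" for i using b(3)[OF that] by (simp add: h_def)
    have "(\<Sum>i<n. b (Suc i) - b i) = 2 * pi" using sum_lessThan_telescope[of b n] b by simp
    then have hpi: "(\<Sum>i<n. h i) = pi" by (simp add: h_def flip: sum_divide_distrib)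
    define \<sigma> where "\<sigma> = (\<lambda>i. Suc i mod n)"
    have \<sigma>: "\<sigma> i < n" for i using n by (simp add: \<sigma>_def)
    have sh: "s (\<sigma> i) = sinh r * sin (h i)" if "i < n" for i
      using sides[OF that] by (simp add: s_def h_def \<sigma>_def)
    have shift: "(\<Sum>i<n. F (\<sigma> i)) = (\<Sum>i<n. F i)" for F :: "nat \<Rightarrow> real"
      unfolding \<sigma>_def using n by (intro sum_cyclic_shift[of n F]) auto
    obtain m' where m': "m' < n" "\<sigma> m' = m"
    proof (cases m)
      case 0
      then show ?thesis using that[of "n - 1"] n by (simp add: \<sigma>_def)
    next
      case (Suc l)
      then show ?thesis using that[of l] m by (simp add: \<sigma>_def)
    qed
    have half: "h i \<le> pi / 2" if "i < n" for i
    proof (rule half_gaps_le[where s="\<lambda>i. s (\<sigma> i)" and m=m', OF n _ sh h0 hpi m'(1)])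
      show "0 < sinh r" using r by simp
      show "s (\<sigma> i) \<le> s (\<sigma> m')" for i using dD[OF \<sigma>] by (simp add: m' m s_def)
      show "pi \<le> (\<Sum>i<n. arcsin (s (\<sigma> i) / s (\<sigma> m')))"
        unfolding m' using ge shift[of "\<lambda>i. arcsin (s i / s m)"] by simp
    qed (use that in auto)
    \<comment> \<open>Here the center must lie in the polygon: \<open>arcsin\<close> recovers a half
      gap only up to \<open>pi / 2\<close>.\<close>
    have "arcsin (s (\<sigma> i) / sinh r) = h i" if "i < n" for i
      using sh[OF that] r arcsin_sin[of "h i"] half[OF that] h0[OF that] by simp
    then have "(\<Sum>i<n. arcsin (s (\<sigma> i) / sinh r)) = pi" using hpi by simp
    then have "(\<Sum>i<n. arcsin (s i / sinh r)) = pi" using shift[of "\<lambda>i. arcsin (s i / sinh r)"] by simp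
    moreover have "s i \<le> sinh r" if "i < n" for i
    proof -
      obtain j where "j < n" "\<sigma> j = i"
      proof (cases i)
        case 0
        then show ?thesis using that[of "n - 1"] n by (simp add: \<sigma>_def)
      next
        case (Suc l)
        then show ?thesis using that[of l] \<open>i < n\<close> by (simp add: \<sigma>_def)
      qed
      then show ?thesis using sh[of j] r mult_left_mono[of "sin (h j)" 1 "sinh r"] by simp
    qed
    ultimately have "sinh r = sinh J"
      using n sJ J(2) by (intro circumradius_unique[of n s "sinh r" "sinh J"]) auto
    then have rJ: "r = J" by simp
    have "A = 2 * (\<Sum>i<n. arcsin (tanh (d i / 2) / tanh r)) - 2 * pi"
      unfolding A area
    proof (rule polygon_area_formula[where n=n and d=d and b=b, OF _ r b(1,2) _ sides])
      show "b i < b (Suc i) \<and> b (Suc i) \<le> b i + pi" if "i < n" for i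
        using h0[OF that] half[OF that] by (simp add: h_def)
    qed (use n in auto)
    then show "A = V" unfolding rJ V_def .
  qed
  define a where "a = (\<lambda>i. arcsin (s i / sinh J))"
  have a: "0 < a i" "a i \<le> pi / 2" "sin (a i) = s i / sinh J" if "i < n" for i
  proof -
    have q: "0 < s i / sinh J" "s i / sinh J \<le> 1" using sJ[OF that] J0 by auto
    then show "sin (a i) = s i / sinh J" "a i \<le> pi / 2"
      unfolding a_def using arcsin_bounded[of "s i / sinh J"] by auto
    show "0 < a i" unfolding a_def using arcsin_strict_mono[of 0 "s i / sinh J"] q by simp
  qed
  \<comment> \<open>Partial sums of the central angles, beginning with that of side 1, because side
    0 is the one that closes the polygon.\<close>
  define b where "b = (\<lambda>i. \<Sum>k<i. 2 * a (Suc k mod n))"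
  have b_gap: "b (Suc i) - b i = 2 * a (Suc i mod n)" for i by (simp add: b_def)
  have "b n = (\<Sum>i<n. 2 * a i)"
    unfolding b_def using n by (intro sum_cyclic_shift[of n "\<lambda>k. 2 * a k"]) auto
  also have "\<dots> = 2 * pi" using J(2) by (simp add: a_def flip: sum_distrib_left)
  finally have bn: "b n = 2 * pi" .
  have mod: "Suc i mod n < n" for i using n by simp
  have b_less: "b i < b (Suc i)" for i using b_gap[of i] a(1)[OF mod[of i]] by linarith
  have sides: "d (Suc i mod n) = 2 * arsinh (sinh J * sin ((b (Suc i) - b i) / 2))" for i
    unfolding b_gap using a(3)[OF mod[of i]] J0 by (simp add: s_def arsinh_sinh_real)
  have "cyclic_ngon n d (\<lambda>i. complex_of_real (tanh J) * cis (b i))"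
    using n J0 bn b_less sides by (intro cyclic_ngon_on_circle) (auto simp: b_def)
  then have "D0 n d = V"
    unfolding D0_def using unique by (intro the_equality) blast+
  then show ?thesis
    using J0 J d0 dD by (intro exI[of _ J]) (force simp: V_def s_def)
qed

theorem corollary2p4:
  fixes n :: nat and d d' :: "nat \<Rightarrow> real" and \<sigma> :: "nat \<Rightarrow> nat"
  assumes "n \<ge> 3"
    and "d \<in> C_set n \<union> BC_set n"
    and "d' \<in> C_set n \<union> BC_set n"
    and "\<sigma> permutes {..<n}"
    and "\<forall>i<n. d (\<sigma> i) \<le> d' i"
    and "\<exists>i<n. d (\<sigma> i) < d' i"
  shows "D0 n d < D0 n d'"
proof -
  obtain J where J: "0 < J" "\<And>i. i < n \<Longrightarrow> 0 < d i \<and> d i / 2 \<le> J"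
    "(\<Sum>i<n. arcsin (sinh (d i / 2) / sinh J)) = pi"
    "D0 n d = 2 * (\<Sum>i<n. arcsin (tanh (d i / 2) / tanh J)) - 2 * pi"
    using D0_formula[OF assms(1,2)] by auto
  obtain J' where J': "0 < J'" "\<And>i. i < n \<Longrightarrow> 0 < d' i \<and> d' i / 2 \<le> J'"
    "(\<Sum>i<n. arcsin (sinh (d' i / 2) / sinh J')) = pi"
    "D0 n d' = 2 * (\<Sum>i<n. arcsin (tanh (d' i / 2) / tanh J')) - 2 * pi"
    using D0_formula[OF assms(1,3)] by auto
  \<comment> \<open>Circumradius and area depend only on sums over the sides, so a permutation
    merely reorders them.\<close>
  have perm: "(\<Sum>i<n. F (d (\<sigma> i))) = (\<Sum>i<n. F (d i))" for F :: "real \<Rightarrow> real"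
    using sum.permute[OF assms(4), of "\<lambda>i. F (d i)"] by (simp add: o_def)
  have \<sigma>: "\<sigma> i < n" if "i < n" for i using permutes_in_image[OF assms(4), of i] that by simp
  obtain k where k: "k < n" "d (\<sigma> k) < d' k" using assms(6) by auto
  have "(\<Sum>i<n. arcsin (tanh (d (\<sigma> i) / 2) / tanh J)) < (\<Sum>i<n. arcsin (tanh (d' i / 2) / tanh J'))"
  proof (rule sum_arcsin_tanh_less[OF assms(1) _ k(1)])
    show "0 < d (\<sigma> i) / 2 \<and> d (\<sigma> i) / 2 \<le> d' i / 2 \<and> d (\<sigma> i) / 2 \<le> J \<and> d' i / 2 \<le> J'"
      if "i < n" for i using J(2)[OF \<sigma>[OF that]] J'(2)[OF that] assms(5) that by simp
    show "(\<Sum>i<n. arcsin (sinh (d (\<sigma> i) / 2) / sinh J)) = pi"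
      using perm[of "\<lambda>t. arcsin (sinh (t / 2) / sinh J)"] J(3) by simp
  qed (use J J' k in auto)
  then show ?thesis
    using perm[of "\<lambda>t. arcsin (tanh (t / 2) / tanh J)"] J(4) J'(4) by simp
qed

end
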